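(* Let $m,n$ be positive integers. Every triple of partitions $(\lambda,\mu,\nu)$ with $\ell(\lambda)\le mn$, $\ell(\mu)\le m$, $\ell(\nu)\le n$ satisfying $$\mu_u=\lambda_u+\sum_{i=m+(u-1)(n-1)+1}^{m+u(n-1)}\lambda_i\ (u=1,\dots,m),\quad \nu_1=\sum_{i=1}^m\lambda_i,\quad \nu_v=\sum_{i=0}^{m-1}\lambda_{m+(n-1)i+v-1}\ (v=2,\dots,n)\qquad(\ast)$$ is a stable triple. Moreover, the cone $\tau_{m,n}$ is a stable face of $PKron_{mn,m,n}$.
   Context: Partitions are padded with zeros: $\lambda=(\lambda_1,\dots,\lambda_{mn})$, $\mu=(\mu_1,\dots,\mu_m)$, $\nu=(\nu_1,\dots,\nu_n)$; $g_{\lambda,\mu,\nu}$ is the Kronecker coefficient (multiplicity of $V_\lambda$ in $V_\mu\otimes V_\nu$ as $\mathfrak S_N$-modules, zero if sizes differ). Sums of partitions are taken componentwise, $k\lambda$ multiplies each part by $k$. A triple $(\lambda,\mu,\nu)$ is stable if for all partitions $\alpha,\beta,\gamma$ the sequence $(g_{\alpha+k\lambda,\beta+k\mu,\gamma+k\nu})_{k\ge0}$ is eventually constant. It is weakly stable if $g_{k\lambda,k\mu,k\nu}=1$ for every positive integer $k$. For positive integers $l,m,n$, $PKron_{l,m,n}\subset\mathbb R^{l+m+n}$ is the rational polyhedral cone generated by the semigroup $\{(\lambda,\mu,\nu)\in\mathbb Z^{l+m+n}: g_{\lambda,\mu,\nu}\ne0,\ \ell(\lambda)\le l,\ell(\mu)\le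 m,\ell(\nu)\le n\}$; $W_{l,m,n}$ is the lattice of $(\lambda,\mu,\nu)\in\mathbb Z^{l+m+n}$ with $|\lambda|=|\mu|=|\nu|$; $SKron_{l,m,n}$ is the set of weakly stable triples with these length bounds. A stable face of $PKron_{l,m,n}$ is a face whose intersection with $W_{l,m,n}$ is contained in $SKron_{l,m,n}$. $\tau_{m,n}\subset\mathbb R^{mn+m+n}$ is the cone of $(\lambda,\mu,\nu)$ satisfying the equations $(\ast)$ together with $\lambda_1\ge\dots\ge\lambda_{mn}\ge0$, $\mu_1\ge\dots\ge\mu_m\ge0$, $\nu_1\ge\dots\ge\nu_n\ge0$. *)

theory Defs
  imports "HOL-Analysis.Analysis" "HOL-Library.Function_Algebras" "HOL-Combinatorics.Permutations"
begin

instantiation "fun" :: (type, real_vector) real_vector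
begin
definition scaleR_fun_def: "scaleR r f = (\<lambda>x. scaleR r (f x))"
instance
  by standard (auto simp: scaleR_fun_def fun_eq_iff scaleR_add_right scaleR_add_left)
end

definition getd :: "nat list \<Rightarrow> nat \<Rightarrow> nat" where
  "getd xs i = (if i < length xs then xs ! i else 0)"

definition is_part :: "nat list \<Rightarrow> bool" where
  "is_part xs \<longleftrightarrow> sorted_wrt (\<ge>) xs"

text \<open>A partition with at most l parts, written padded with zeros to exactly l entries.\<close>
definition part_len :: "nat \<Rightarrow> nat list \<Rightarrow> bool" where
  "part_len l xs \<longleftrightarrow> length xs = l \<and> is_part xs"

definition padd :: "nat list \<Rightarrow> nat list \<Rightarrow> nat list" where
  "padd xs ys = map (\<lambda>i. getd xs i + getd ys i) [0..<max (length xs) (length ys)]"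

definition psmul :: "nat \<Rightarrow> nat list \<Rightarrow> nat list" where
  "psmul k xs = map (\<lambda>x. k * x) xs"

text \<open>Permutation character of the Young subgroup for a composition alpha
  (zero if some part is negative): number of ordered set partitions of
  {0..<N} into blocks of sizes alpha, each block fixed by sg.\<close>
definition eta :: "int list \<Rightarrow> nat \<Rightarrow> (nat \<Rightarrow> nat) \<Rightarrow> nat" where
  "eta alpha N sg =
    (if (\<exists>a\<in>set alpha. a < 0) then 0 else
     card {f \<in> {0..<N} \<rightarrow>\<^sub>E {0..<length alpha}.
             (\<forall>j<length alpha. card {x\<in>{0..<N}. f x = j} = nat (alpha ! j)) \<and>
             (\<forall>x<N. f (sg x) = f x)})"

text \<open>Irreducible character chi^lambda of S_N (N = |lambda|) at sg,
  via the determinantal (Jacobi--Trudi) formula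
  chi^lambda = sum_w sgn(w) eta^(lambda_i - i + w(i)).\<close>
definition chi :: "nat list \<Rightarrow> (nat \<Rightarrow> nat) \<Rightarrow> int" where
  "chi lam sg =
    (\<Sum>w | w permutes {0..<length lam}.
       sign w * int (eta (map (\<lambda>i. int (lam ! i) - int i + int (w i)) [0..<length lam])
                         (sum_list lam) sg))"

text \<open>Kronecker coefficient: multiplicity of V_lambda in V_mu (x) V_nu,
  i.e. (1/N!) sum_sigma chi^lambda chi^mu chi^nu; zero if sizes differ.\<close>
definition kron :: "nat list \<Rightarrow> nat list \<Rightarrow> nat list \<Rightarrow> int" where
  "kron lam mu nu =
    (if sum_list lam = sum_list mu \<and> sum_list mu = sum_list nu then
       (\<Sum>sg | sg permutes {0..<sum_list lam}.
          chi lam sg * chi mu sg * chi nu sg) div int (fact (sum_list lam))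
     else 0)"

definition stable_triple :: "nat list \<Rightarrow> nat list \<Rightarrow> nat list \<Rightarrow> bool" where
  "stable_triple lam mu nu \<longleftrightarrow>
    (\<forall>al be ga. is_part al \<and> is_part be \<and> is_part ga \<longrightarrow>
      (\<exists>K c. \<forall>k\<ge>K. kron (padd al (psmul k lam)) (padd be (psmul k mu)) (padd ga (psmul k nu)) = c))"

definition weakly_stable :: "nat list \<Rightarrow> nat list \<Rightarrow> nat list \<Rightarrow> bool" where
  "weakly_stable lam mu nu \<longleftrightarrow>
    (\<forall>k::nat. k > 0 \<longrightarrow> kron (psmul k lam) (psmul k mu) (psmul k nu) = 1)"

section \<open>The equations (*), with 1-based indexing of the argument functions\<close>

definition star_eqs :: "nat \<Rightarrow> nat \<Rightarrow> (nat \<Rightarrow> 'a::comm_monoid_add) \<Rightarrow> (nat \<Rightarrow> 'a) \<Rightarrow> (nat \<Rightarrow> 'a) \<Rightarrow> bool" where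
  "star_eqs m n L M N \<longleftrightarrow>
    (\<forall>u\<in>{1..m}. M u = L u + (\<Sum>i\<in>{m + (u-1)*(n-1) + 1 .. m + u*(n-1)}. L i)) \<and>
    N 1 = (\<Sum>i\<in>{1..m}. L i) \<and>
    (\<forall>v\<in>{2..n}. N v = (\<Sum>i\<in>{0..m-1}. L (m + (n-1)*i + v - 1)))"

definition at1 :: "nat list \<Rightarrow> nat \<Rightarrow> nat" where
  "at1 xs i = getd xs (i - 1)"

text \<open>A point of R^(l+m+n) is a triple of functions nat => real, the
  i-th coordinate (0-based) of each block being the value at i; coordinates beyond
  l (resp. m, n) are zero.\<close>
type_synonym pt = "(nat \<Rightarrow> real) \<times> (nat \<Rightarrow> real) \<times> (nat \<Rightarrow> real)"

definition vec_of :: "nat list \<Rightarrow> nat \<Rightarrow> real" where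
  "vec_of xs = (\<lambda>i. if i < length xs then real (xs ! i) else 0)"

definition emb :: "nat list \<times> nat list \<times> nat list \<Rightarrow> pt" where
  "emb t = (case t of (a, b, c) \<Rightarrow> (vec_of a, vec_of b, vec_of c))"

definition supp_in :: "nat \<Rightarrow> nat \<Rightarrow> nat \<Rightarrow> pt \<Rightarrow> bool" where
  "supp_in l m n p = (case p of (x, y, z) \<Rightarrow>
     (\<forall>i\<ge>l. x i = 0) \<and> (\<forall>i\<ge>m. y i = 0) \<and> (\<forall>i\<ge>n. z i = 0))"

definition KronSG :: "nat \<Rightarrow> nat \<Rightarrow> nat \<Rightarrow> (nat list \<times> nat list \<times> nat list) set" where
  "KronSG l m n = {(lam, mu, nu). part_len l lam \<and> part_len m mu \<and> part_len n nu \<and> kron lam mu nu \<noteq> 0}"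

definition gen_cone :: "pt set \<Rightarrow> pt set" where
  "gen_cone S = {p. \<exists>F c. finite F \<and> F \<subseteq> S \<and> (\<forall>v\<in>F. c v \<ge> 0) \<and> p = (\<Sum>v\<in>F. c v *\<^sub>R v)}"

definition PKron :: "nat \<Rightarrow> nat \<Rightarrow> nat \<Rightarrow> pt set" where
  "PKron l m n = gen_cone (emb ` KronSG l m n)"

definition Wlat :: "nat \<Rightarrow> nat \<Rightarrow> nat \<Rightarrow> pt set" where
  "Wlat l m n = {(x, y, z). supp_in l m n (x, y, z) \<and>
      (\<forall>i. x i \<in> \<int> \<and> y i \<in> \<int> \<and> z i \<in> \<int>) \<and>
      (\<Sum>i<l. x i) = (\<Sum>i<m. y i) \<and> (\<Sum>i<m. y i) = (\<Sum>i<n. z i)}"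

definition SKron :: "nat \<Rightarrow> nat \<Rightarrow> nat \<Rightarrow> (nat list \<times> nat list \<times> nat list) set" where
  "SKron l m n = {(lam, mu, nu). part_len l lam \<and> part_len m mu \<and> part_len n nu \<and> weakly_stable lam mu nu}"

definition stable_face :: "nat \<Rightarrow> nat \<Rightarrow> nat \<Rightarrow> pt set \<Rightarrow> bool" where
  "stable_face l m n F \<longleftrightarrow> F face_of PKron l m n \<and> F \<inter> Wlat l m n \<subseteq> emb ` SKron l m n"

definition tau :: "nat \<Rightarrow> nat \<Rightarrow> pt set" where
  "tau m n = {(x, y, z). supp_in (m*n) m n (x, y, z) \<and>
      star_eqs m n (\<lambda>i. x (i - 1)) (\<lambda>i. y (i - 1)) (\<lambda>i. z (i - 1)) \<and>
      (\<forall>i. Suc i < m*n \<longrightarrow> x (Suc i) \<le> x i) \<and> (m*n > 0 \<longrightarrow> x (m*n - 1) \<ge> 0) \<and>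
      (\<forall>i. Suc i < m \<longrightarrow> y (Suc i) \<le> y i) \<and> (m > 0 \<longrightarrow> y (m - 1) \<ge> 0) \<and>
      (\<forall>i. Suc i < n \<longrightarrow> z (Suc i) \<le> z i) \<and> (n > 0 \<longrightarrow> z (n - 1) \<ge> 0)}"

end

theory Submission
  imports Defs
begin

text \<open>
  Writing the irreducible characters by the determinantal formula, a product of permutation
  characters of Young subgroups is a sum over contingency tables, and so \<open>g\<^bsub>\<lambda>,\<mu>,\<nu>\<^esub>\<close> is an
  alternating sum over \<open>w\<close>, \<open>v\<close> of Kostka numbers \<open>K\<^bsub>\<lambda>,B\<^esub>\<close>, where \<open>B\<close> runs over the tables with margins
  \<open>w * \<mu>\<close> and \<open>v * \<nu>\<close>. The equations \<open>(\<ast>)\<close> say that \<open>\<mu>\<close>, \<open>\<nu>\<close> are the margins of the matrix \<open>A\<close>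
  obtained by writing \<open>\<lambda>\<close> first down the first column and then along the rows. This order of the
  cells is induced by weights \<open>x\<^sub>i + y\<^sub>j\<close> (\<open>A\<close> is an additive matrix).
  If \<open>K\<^bsub>\<lambda>,B\<^esub> \<noteq> 0\<close>, then \<open>\<lambda>\<close> dominates \<open>B\<close>, and pairing with the weights shows that \<open>\<Sum> \<lambda>\<^sub>k (x + y)\<^sub>k - \<Sum> x\<^sub>i \<mu>\<^sub>i - \<Sum> y\<^sub>j \<nu>\<^sub>j\<close> is nonnegative, and that it
  vanishes only if \<open>w = v = id\<close> and \<open>B = A\<close>. This yields the supporting hyperplane of the face and
  \<open>g = 1\<close> on it. For stability the same pairing leaves only the tables \<open>B = k A + D\<close> with \<open>D\<close> in a
  finite set independent of \<open>k\<close>, and each Kostka number \<open>K\<^bsub>\<alpha> + k \<lambda>, k A + D\<^esub>\<close> is eventually constant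
  by the branching rule.
\<close>

section \<open>Permutation characters and contingency tables\<close>

text \<open>The three families of signs are treated differently. Those of \<lambda> are absorbed
  into the Kostka number, here a signed count, so its vanishing outside dominance is a matter of
  cancellation; it is drawn from the branching rule, which is proved by a sign-reversing involution.
  The signs of \<mu> and \<nu> stay outside. Replacing \<mu> by \<open>shift \<mu> w\<close> can
  only raise the pairing with a decreasing weight (a rearrangement inequality), so the terms with
  other \<open>w\<close> or \<open>v\<close> leave less room, not more. Two properties of the
  weights matter. Strict decrease along the cells makes Abel summation bound every partial sum of
  \<lambda> - B; additivity makes the pairing with B depend on the margins only. In the stability
  statement the added partitions may have more than mn, m, n parts, so tables leave the m by n
  corner. The weights are therefore positive in the corner and at most 0 elsewhere. There the
  inequality no longer forces w = v = id, but it confines B to a bounded distance from k A, which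
  suffices.\<close>

definition colourings :: "nat \<Rightarrow> 'j set \<Rightarrow> ('j \<Rightarrow> int) \<Rightarrow> (nat \<Rightarrow> 'j) set" where
  "colourings N J a = {f \<in> {..<N} \<rightarrow>\<^sub>E J. \<forall>j\<in>J. int (card {x\<in>{..<N}. f x = j}) = a j}"

definition fixcount :: "nat \<Rightarrow> 'j set \<Rightarrow> ('j \<Rightarrow> int) \<Rightarrow> (nat \<Rightarrow> nat) \<Rightarrow> nat" where
  "fixcount N J a sg = card {f \<in> colourings N J a. \<forall>x<N. f (sg x) = f x}"

text \<open>Contingency tables. The entries are nonnegative but the margins are arbitrary integers,
  because the determinantal formula produces negative ones; for these the set is empty.\<close>

definition tables :: "'i set \<Rightarrow> 'j set \<Rightarrow> ('i \<Rightarrow> int) \<Rightarrow> ('j \<Rightarrow> int) \<Rightarrow> ('i \<times> 'j \<Rightarrow> int) set" where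
  "tables I J a b = {B \<in> I \<times> J \<rightarrow>\<^sub>E {0..}.
     (\<forall>i\<in>I. (\<Sum>j\<in>J. B (i, j)) = a i) \<and> (\<forall>j\<in>J. (\<Sum>i\<in>I. B (i, j)) = b j)}"

lemma eta_eq_fixcount: "eta al N sg = fixcount N {..<length al} (\<lambda>j. al ! j) sg"
proof (cases "\<exists>a\<in>set al. a < 0")
  case True
  then obtain j where j: "j < length al" "al ! j < 0"
    by (auto simp: in_set_conv_nth)
  then have "colourings N {..<length al} (\<lambda>j. al ! j) = {}"
    unfolding colourings_def by (force simp flip: not_le)
  with True show ?thesis
    by (auto simp: eta_def fixcount_def)
next
  case False
  then have nn: "al ! j \<ge> 0" if "j < length al" for j
    using that by (meson not_less nth_mem)
  have "{f \<in> {0..<N} \<rightarrow>\<^sub>E {0..<length al}.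
             (\<forall>j<length al. card {x\<in>{0..<N}. f x = j} = nat (al ! j)) \<and>
             (\<forall>x<N. f (sg x) = f x)}
        = {f \<in> colourings N {..<length al} (\<lambda>j. al ! j). \<forall>x<N. f (sg x) = f x}"
    unfolding colourings_def atLeast0LessThan using nn by (auto simp: nat_eq_iff2 nat_eq_iff)
  with False show ?thesis
    by (simp add: eta_def fixcount_def)
qed

lemma finite_colourings: "finite J \<Longrightarrow> finite (colourings N J a)"
  unfolding colourings_def by (rule finite_subset[of _ "{..<N} \<rightarrow>\<^sub>E J"]) (auto intro: finite_PiE)

lemma finite_tables:
  assumes "finite I" "finite J"
  shows "finite (tables I J a b)"
proof (rule finite_subset)
  show "tables I J a b \<subseteq> (\<Pi>\<^sub>E c\<in>I\<times>J. {0..a (fst c)})"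
  proof
    fix B assume B: "B \<in> tables I J a b"
    have "B (i, j) \<le> a i" if "i \<in> I" "j \<in> J" for i j
    proof -
      have "B (i, j) \<le> (\<Sum>j\<in>J. B (i, j))"
        using that B assms by (intro member_le_sum) (auto simp: tables_def PiE_def Pi_def)
      then show ?thesis using B that by (simp add: tables_def)
    qed
    then show "B \<in> (\<Pi>\<^sub>E c\<in>I\<times>J. {0..a (fst c)})"
      using B by (auto simp: tables_def PiE_def Pi_def)
  qed
  show "finite (\<Pi>\<^sub>E c\<in>I\<times>J. {0..a (fst c)})"
    using assms by (intro finite_PiE) auto
qed

lemma card_fibre_split:
  assumes "finite J" "\<And>x. x < N \<Longrightarrow> g x \<in> J"
  shows "card {x\<in>{..<N::nat}. P x} = (\<Sum>j\<in>J. card {x\<in>{..<N}. P x \<and> g x = j})"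
proof -
  have "{x\<in>{..<N}. P x} = (\<Union>j\<in>J. {x\<in>{..<N}. P x \<and> g x = j})"
    using assms by auto
  also have "card \<dots> = (\<Sum>j\<in>J. card {x\<in>{..<N}. P x \<and> g x = j})"
    using assms by (intro card_UN_disjoint) auto
  finally show ?thesis .
qed

text \<open>A pair of fixed colourings is one fixed colouring by pairs. Sorting these by their joint
  block sizes gives one summand per table: the double coset decomposition of a product of Young
  permutation characters.\<close>

lemma fixcount_mult:
  assumes I: "finite I" and J: "finite J"
  assumes sg: "\<And>x. x < N \<Longrightarrow> sg x < N"
  shows "fixcount N I a sg * fixcount N J b sg = (\<Sum>B\<in>tables I J a b. fixcount N (I \<times> J) B sg)"
proof -
  define F where "F = {f \<in> colourings N I a. \<forall>x<N. f (sg x) = f x}"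
  define G where "G = {f \<in> colourings N J b. \<forall>x<N. f (sg x) = f x}"
  define H where "H = (\<lambda>B. {f \<in> colourings N (I \<times> J) B. \<forall>x<N. f (sg x) = f x})"
  define \<Phi> where "\<Phi> = (\<lambda>(f, g). \<lambda>x\<in>{..<N}. (f x :: 'a, g x :: 'b))"
  define \<Psi> where "\<Psi> = (\<lambda>h. (\<lambda>x\<in>{..<N}. fst (h x :: 'a \<times> 'b), \<lambda>x\<in>{..<N}. snd (h x)))"
  have fwd: "\<Phi> ` (F \<times> G) \<subseteq> (\<Union>B\<in>tables I J a b. H B)"
  proof safe
    fix f g assume f: "f \<in> F" and g: "g \<in> G"
    define B where "B = (\<lambda>c\<in>I\<times>J. int (card {x\<in>{..<N}. f x = fst c \<and> g x = snd c}))"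
    have fI: "f x \<in> I" "g x \<in> J" if "x < N" for x
      using f g that by (auto simp: F_def G_def colourings_def)
    have "(\<Sum>j\<in>J. B (i, j)) = a i" if "i \<in> I" for i
    proof -
      have "(\<Sum>j\<in>J. B (i, j)) = int (card {x\<in>{..<N}. f x = i})"
        using card_fibre_split[OF J, of N g "\<lambda>x. f x = i"] fI that by (simp add: B_def)
      with that f show ?thesis by (auto simp: F_def colourings_def)
    qed
    moreover have "(\<Sum>i\<in>I. B (i, j)) = b j" if "j \<in> J" for j
    proof -
      have "(\<Sum>i\<in>I. B (i, j)) = int (card {x\<in>{..<N}. g x = j})"
        using card_fibre_split[OF I, of N f "\<lambda>x. g x = j"] fI that by (simp add: B_def conj_commute)
      with that g show ?thesis by (auto simp: G_def colourings_def)
    qed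
    ultimately have "B \<in> tables I J a b"
      by (auto simp: tables_def B_def)
    moreover have "\<Phi> (f, g) \<in> H B"
    proof -
      have "{x\<in>{..<N}. \<Phi> (f, g) x = (i, j)} = {x\<in>{..<N}. f x = i \<and> g x = j}" for i j
        by (auto simp: \<Phi>_def)
      then show ?thesis
        using f g fI sg by (auto simp: H_def B_def colourings_def F_def G_def \<Phi>_def)
    qed
    ultimately show "\<Phi> (f, g) \<in> (\<Union>B\<in>tables I J a b. H B)" by blast
  qed
  have bwd: "\<Psi> ` (\<Union>B\<in>tables I J a b. H B) \<subseteq> F \<times> G"
  proof (clarify)
    fix h B f g assume B: "B \<in> tables I J a b" and h: "h \<in> H B" and fg: "(f, g) = \<Psi> h"
    have hIJ: "fst (h x) \<in> I" "snd (h x) \<in> J" if "x < N" for x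
    proof -
      have "h x \<in> I \<times> J"
        using h that by (auto simp: H_def colourings_def PiE_def Pi_def)
      then show "fst (h x) \<in> I" "snd (h x) \<in> J" by (auto simp: mem_Times_iff)
    qed
    have cnt: "int (card {x\<in>{..<N}. fst (h x) = i \<and> snd (h x) = j}) = B (i, j)" if "i \<in> I" "j \<in> J" for i j
    proof -
      have "{x\<in>{..<N}. fst (h x) = i \<and> snd (h x) = j} = {x\<in>{..<N}. h x = (i, j)}"
        by (auto simp: prod_eq_iff)
      then show ?thesis using h that by (simp add: H_def colourings_def)
    qed
    have "int (card {x\<in>{..<N}. f x = i}) = a i" if i: "i \<in> I" for i
    proof -
      have "{x\<in>{..<N}. f x = i} = {x\<in>{..<N}. fst (h x) = i}"
        using fg by (auto simp: \<Psi>_def)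
      then have "int (card {x\<in>{..<N}. f x = i}) = (\<Sum>j\<in>J. B (i, j))"
        using card_fibre_split[OF J, of N "\<lambda>x. snd (h x)" "\<lambda>x. fst (h x) = i"] hIJ cnt i by simp
      with B i show ?thesis by (simp add: tables_def)
    qed
    moreover have "int (card {x\<in>{..<N}. g x = j}) = b j" if j: "j \<in> J" for j
    proof -
      have "{x\<in>{..<N}. g x = j} = {x\<in>{..<N}. snd (h x) = j}"
        using fg by (auto simp: \<Psi>_def)
      then have "int (card {x\<in>{..<N}. g x = j}) = (\<Sum>i\<in>I. B (i, j))"
        using card_fibre_split[OF I, of N "\<lambda>x. fst (h x)" "\<lambda>x. snd (h x) = j"] hIJ cnt j
        by (simp add: conj_commute)
      with B j show ?thesis by (simp add: tables_def)
    qed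
    ultimately show "f \<in> F \<and> g \<in> G"
      using fg hIJ h sg by (auto simp: F_def G_def colourings_def \<Psi>_def H_def)
  qed
  have "bij_betw \<Phi> (F \<times> G) (\<Union>B\<in>tables I J a b. H B)"
  proof (rule bij_betw_byWitness[where f' = \<Psi>])
    show "\<forall>p\<in>F \<times> G. \<Psi> (\<Phi> p) = p"
      by (auto simp: F_def G_def \<Phi>_def \<Psi>_def colourings_def PiE_def extensional_def fun_eq_iff)
    show "\<forall>h\<in>\<Union>B\<in>tables I J a b. H B. \<Phi> (\<Psi> h) = h"
      by (auto simp: H_def \<Phi>_def \<Psi>_def colourings_def PiE_def extensional_def fun_eq_iff)
  qed (use fwd bwd in auto)
  then have "card F * card G = card (\<Union>B\<in>tables I J a b. H B)"
    by (simp add: bij_betw_same_card card_cartesian_product flip: bij_betw_same_card)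
  also have "\<dots> = (\<Sum>B\<in>tables I J a b. card (H B))"
  proof (rule card_UN_disjoint)
    show "finite (tables I J a b)" using I J by (rule finite_tables)
    show "\<forall>B\<in>tables I J a b. finite (H B)"
      using finite_colourings[of "I \<times> J"] I J by (auto simp: H_def)
    show "\<forall>B\<in>tables I J a b. \<forall>B'\<in>tables I J a b. B \<noteq> B' \<longrightarrow> H B \<inter> H B' = {}"
    proof (intro ballI impI)
      fix B B' assume B: "B \<in> tables I J a b" "B' \<in> tables I J a b" and ne: "B \<noteq> B'"
      show "H B \<inter> H B' = {}"
      proof (rule ccontr)
        assume "H B \<inter> H B' \<noteq> {}"
        then obtain h where "h \<in> H B" "h \<in> H B'" by blast
        then have "B c = B' c" if "c \<in> I \<times> J" for c
          using that unfolding H_def colourings_def by fastforce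
        with B have "B = B'"
          unfolding tables_def by (intro PiE_ext[of B "I \<times> J"]) auto
        with ne show False by simp
      qed
    qed
  qed
  finally show ?thesis by (simp add: F_def G_def H_def fixcount_def)
qed

section \<open>Transitivity of the symmetric group on colourings and orbit counting\<close>

lemma colourings_nonempty:
  assumes J: "finite J" and c: "\<And>j. j \<in> J \<Longrightarrow> c j \<ge> 0" and N: "sum c J = int N"
  obtains f where "f \<in> colourings N J c"
proof -
  obtain xs where xs: "mset xs = (\<Sum>j\<in>J. replicate_mset (nat (c j)) j)"
    using ex_mset by blast
  have "size (mset xs) = (\<Sum>j\<in>J. nat (c j))"
    unfolding xs by (simp add: size_multiset_sum)
  also have "int \<dots> = int N" using c N by simp
  finally have len: "length xs = N" by simp
  have cnt: "count (mset xs) j = nat (c j)" if "j \<in> J" for j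
    unfolding xs using J that by (simp add: count_sum sum.delta)
  have sub: "set xs \<subseteq> J"
  proof -
    have "set xs = set_mset (mset xs)" by simp
    also have "\<dots> \<subseteq> J" unfolding xs using J by (auto simp: set_mset_sum split: if_splits)
    finally show ?thesis .
  qed
  have "(\<lambda>x\<in>{..<N}. xs ! x) \<in> colourings N J c"
    unfolding colourings_def
  proof (intro CollectI conjI ballI)
    show "(\<lambda>x\<in>{..<N}. xs ! x) \<in> {..<N} \<rightarrow>\<^sub>E J"
      using sub len by (auto dest: nth_mem)
    fix j assume j: "j \<in> J"
    have "{x\<in>{..<N}. (\<lambda>x\<in>{..<N}. xs ! x) x = j} = {i. i < length xs \<and> xs ! i = j}"
      using len by auto
    also have "card \<dots> = count (mset xs) j"
      by (simp add: length_filter_conv_card[symmetric] count_mset count_list_eq_length_filter eq_commute)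
    finally show "int (card {x\<in>{..<N}. (\<lambda>x\<in>{..<N}. xs ! x) x = j}) = c j"
      using cnt j c by simp
  qed
  then show ?thesis by (rule that)
qed

lemma colourings_conjugate:
  assumes "finite J" "f \<in> colourings N J c" "g \<in> colourings N J c"
  obtains p where "p permutes {..<N}" "\<And>x. x < N \<Longrightarrow> g x = f (p x)"
proof -
  have cnt: "count (image_mset h (mset_set {..<N})) j = (if j \<in> J then nat (c j) else 0)"
    if h: "h \<in> colourings N J c" for h j
  proof (cases "j \<in> J")
    case True
    have "count (image_mset h (mset_set {..<N})) j = card {x\<in>{..<N}. h x = j}"
      by (simp add: count_image_mset Int_def conj_commute)
    moreover have "int (card {x\<in>{..<N}. h x = j}) = c j"
      using h True by (simp add: colourings_def)
    ultimately show ?thesis using True by simp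
  next
    case False
    then have "j \<notin># image_mset h (mset_set {..<N})"
      using h by (auto simp: colourings_def)
    then show ?thesis using False by (simp add: count_eq_zero_iff)
  qed
  have "image_mset g (mset_set {..<N}) = image_mset f (mset_set {..<N})"
    using assms by (intro multiset_eqI) (simp add: cnt)
  then obtain p where "p permutes {..<N}" "\<forall>x\<in>{..<N}. g x = f (p x)"
    by (rule image_mset_eq_implies_permutes[rotated]) auto
  then show ?thesis using that by auto
qed

text \<open>Orbit counting for a transitive action. Double counting turns the sum into the total
  size of the stabilisers \<open>T f\<close>. Composing with a permutation \<open>p\<close> such
  that f is \<open>f0\<close> after \<open>p\<close> carries \<open>T f\<close> onto the coset
  \<open>U f\<close>, and these cosets partition the group.\<close>

lemma sum_fixcount:
  fixes J :: "'j set"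
  assumes J: "finite J" and c: "\<And>j. j \<in> J \<Longrightarrow> c j \<ge> 0" and N: "sum c J = int N"
  shows "(\<Sum>sg | sg permutes {..<N}. fixcount N J c sg) = fact N"
proof -
  define X where "X = colourings N J c"
  define P where "P = {sg. sg permutes {..<N}}"
  have finX: "finite X" using J by (simp add: X_def finite_colourings)
  have finP: "finite P" by (simp add: P_def finite_permutations)
  obtain f0 where f0: "f0 \<in> X" using colourings_nonempty[OF assms] X_def by blast
  define T where "T = (\<lambda>f :: nat \<Rightarrow> 'j. {sg \<in> P. \<forall>x<N. f (sg x) = f x})"
  define U where "U = (\<lambda>f :: nat \<Rightarrow> 'j. {sg \<in> P. \<forall>x<N. f0 (sg x) = f x})"
  have "(\<Sum>sg\<in>P. fixcount N J c sg) = (\<Sum>sg\<in>P. \<Sum>f\<in>X. if \<forall>x<N. f (sg x) = f x then 1 else 0)"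
    using finX by (simp add: fixcount_def X_def sum.If_cases Int_def)
  also have "\<dots> = (\<Sum>f\<in>X. \<Sum>sg\<in>P. if \<forall>x<N. f (sg x) = f x then 1 else 0)"
    by (rule sum.swap)
  also have "\<dots> = (\<Sum>f\<in>X. card (T f))"
    using finP by (simp add: T_def sum.If_cases Int_def)
  also have "\<dots> = (\<Sum>f\<in>X. card (U f))"
  proof (rule sum.cong)
    fix f assume f: "f \<in> X"
    obtain p where p: "p permutes {..<N}" and fp: "\<And>x. x < N \<Longrightarrow> f x = f0 (p x)"
      using colourings_conjugate[OF J, of f0 N c f] f f0 by (auto simp: X_def)
    have ip: "inv p permutes {..<N}" using p by (rule permutes_inv)
    have mem: "q x < N" if "q permutes {..<N}" "x < N" for q x
      using permutes_in_image[OF that(1)] that(2) by auto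
    have "bij_betw (\<lambda>sg. p \<circ> sg) (T f) (U f)"
    proof (rule bij_betw_byWitness[where f' = "\<lambda>sg. inv p \<circ> sg"])
      show "\<forall>sg\<in>T f. inv p \<circ> (p \<circ> sg) = sg" "\<forall>sg\<in>U f. p \<circ> (inv p \<circ> sg) = sg"
        using p by (auto simp: fun_eq_iff permutes_inverses)
      show "(\<lambda>sg. p \<circ> sg) ` T f \<subseteq> U f"
        using p fp mem by (auto simp: T_def U_def P_def permutes_compose)
      show "(\<lambda>sg. inv p \<circ> sg) ` U f \<subseteq> T f"
      proof safe
        fix sg assume "sg \<in> U f"
        then have sg: "sg permutes {..<N}" and eq: "\<And>x. x < N \<Longrightarrow> f0 (sg x) = f x"
          by (auto simp: U_def P_def)
        have "f (inv p (sg x)) = f x" if "x < N" for x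
          using fp[of "inv p (sg x)"] mem[OF ip mem[OF sg that]] eq[OF that] p
          by (simp add: permutes_inverses)
        then show "inv p \<circ> sg \<in> T f"
          using sg ip by (auto simp: T_def P_def permutes_compose)
      qed
    qed
    then show "card (T f) = card (U f)" by (rule bij_betw_same_card)
  qed simp
  also have "\<dots> = card (\<Union>f\<in>X. U f)"
  proof (rule card_UN_disjoint[symmetric])
    show "\<forall>f\<in>X. \<forall>g\<in>X. f \<noteq> g \<longrightarrow> U f \<inter> U g = {}"
    proof (intro ballI impI)
      fix f g assume fg: "f \<in> X" "g \<in> X" "f \<noteq> g"
      have "f = g" if "sg \<in> U f" "sg \<in> U g" for sg
      proof (rule PiE_ext)
        show "f \<in> {..<N} \<rightarrow>\<^sub>E J" "g \<in> {..<N} \<rightarrow>\<^sub>E J" using fg by (auto simp: X_def colourings_def)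
        show "f x = g x" if "x \<in> {..<N}" for x
          using \<open>sg \<in> U f\<close> \<open>sg \<in> U g\<close> that by (auto simp: U_def)
      qed
      with fg show "U f \<inter> U g = {}" by blast
    qed
  qed (use finX finP in \<open>auto simp: U_def\<close>)
  also have "(\<Union>f\<in>X. U f) = P"
  proof
    show "P \<subseteq> (\<Union>f\<in>X. U f)"
    proof
      fix sg assume sg: "sg \<in> P"
      then have perm: "sg permutes {..<N}" by (simp add: P_def)
      define f where "f = (\<lambda>x\<in>{..<N}. f0 (sg x))"
      have lt: "sg x < N \<longleftrightarrow> x < N" for x using permutes_in_image[OF perm, of x] by auto
      have "card {x\<in>{..<N}. f x = j} = card {x\<in>{..<N}. f0 x = j}" for j
      proof (rule bij_betw_same_card[of sg])
        show "bij_betw sg {x\<in>{..<N}. f x = j} {x\<in>{..<N}. f0 x = j}"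
        proof (rule bij_betw_byWitness[where f' = "inv sg"])
          have inv_lt: "inv sg x < N" if "x < N" for x
            using permutes_in_image[OF permutes_inv[OF perm], of x] that by auto
          show "inv sg ` {x \<in> {..<N}. f0 x = j} \<subseteq> {x \<in> {..<N}. f x = j}"
          proof (rule image_subsetI)
            fix x assume "x \<in> {x \<in> {..<N}. f0 x = j}"
            then show "inv sg x \<in> {x \<in> {..<N}. f x = j}"
              using inv_lt[of x] by (simp add: f_def permutes_inverses(1)[OF perm])
          qed
        qed (use lt in \<open>auto simp: f_def permutes_inverses[OF perm]\<close>)
      qed
      then have "f \<in> X"
        using f0 lt by (auto simp: X_def colourings_def f_def)
      moreover have "sg \<in> U f" using sg by (simp add: U_def f_def)
      ultimately show "sg \<in> (\<Union>f\<in>X. U f)" by blast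
    qed
  qed (auto simp: U_def)
  also have "card P = fact N"
    unfolding P_def by (subst card_permutations[of _ N]) auto
  finally show ?thesis by (simp add: P_def)
qed

section \<open>From characters to Kostka numbers\<close>

definition shift :: "(nat \<Rightarrow> int) \<Rightarrow> (nat \<Rightarrow> nat) \<Rightarrow> nat \<Rightarrow> int" where
  "shift f w i = f i - int i + int (w i)"

definition kostka :: "nat \<Rightarrow> (nat \<Rightarrow> int) \<Rightarrow> 'c set \<Rightarrow> ('c \<Rightarrow> int) \<Rightarrow> int" where
  "kostka l f J B = (\<Sum>u | u permutes {..<l}. sign u * int (card (tables {..<l} J (shift f u) B)))"

definition parts :: "nat list \<Rightarrow> nat \<Rightarrow> int" where
  "parts xs i = int (getd xs i)"

lemma colourings_cong: "(\<And>j. j \<in> J \<Longrightarrow> a j = b j) \<Longrightarrow> colourings N J a = colourings N J b"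
  unfolding colourings_def by auto

lemma chi_eq:
  "chi lam sg = (\<Sum>w | w permutes {..<length lam}.
     sign w * int (fixcount (sum_list lam) {..<length lam} (shift (parts lam) w) sg))"
proof -
  have "fixcount (sum_list lam) {..<length (map (\<lambda>i. int (lam ! i) - int i + int (w i)) [0..<length lam])}
       (\<lambda>j. map (\<lambda>i. int (lam ! i) - int i + int (w i)) [0..<length lam] ! j) sg
     = fixcount (sum_list lam) {..<length lam} (shift (parts lam) w) sg" for w
    unfolding fixcount_def
    using colourings_cong[of "{..<length lam}" "\<lambda>j. map (\<lambda>i. int (lam ! i) - int i + int (w i)) [0..<length lam] ! j"
        "shift (parts lam) w" "sum_list lam"]
    by (simp add: shift_def parts_def getd_def)
  then show ?thesis
    unfolding chi_def eta_eq_fixcount by (simp add: atLeast0LessThan)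
qed

lemma sum_parts: "(\<Sum>i<length xs. parts xs i) = int (sum_list xs)"
  by (simp add: parts_def getd_def sum_list_sum_nth atLeast0LessThan)

lemma sum_shift:
  assumes "w permutes {..<l}"
  shows "(\<Sum>i<l. shift f w i) = (\<Sum>i<l. f i)"
proof -
  have "(\<Sum>i<l. int (w i)) = (\<Sum>i<l. int i)"
    using sum.permute[OF assms, of int] by (simp add: o_def)
  then show ?thesis by (simp add: shift_def sum.distrib sum_subtractf)
qed

text \<open>Averaging over the group counts orbits, here three-way tables. They are nested: a table
  \<open>B\<close> on \<open>J\<close> and \<open>K\<close> supplies the column sums of the outer
  one, so that the first direction can later collapse into a Kostka number.\<close>

lemma sum_fixcount3:
  assumes "finite I" "finite J" "finite K" "sum a I = int N"
  shows "(\<Sum>sg | sg permutes {..<N}. fixcount N I a sg * (fixcount N J b sg * fixcount N K c sg))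
    = fact N * (\<Sum>B\<in>tables J K b c. card (tables I (J \<times> K) a B))"
proof -
  have eq: "fixcount N I a sg * (fixcount N J b sg * fixcount N K c sg) =
      (\<Sum>B\<in>tables J K b c. \<Sum>C\<in>tables I (J \<times> K) a B. fixcount N (I \<times> (J \<times> K)) C sg)"
    if "sg permutes {..<N}" for sg
  proof -
    have "sg x < N" if "x < N" for x
      using permutes_in_image[OF \<open>sg permutes {..<N}\<close>, of x] that by auto
    then show ?thesis using assms by (simp add: fixcount_mult sum_distrib_left)
  qed
  have av: "(\<Sum>sg | sg permutes {..<N}. fixcount N (I \<times> (J \<times> K)) C sg) = fact N"
    if "C \<in> tables I (J \<times> K) a B" for B C
  proof (rule sum_fixcount)
    have "sum C (I \<times> (J \<times> K)) = (\<Sum>i\<in>I. \<Sum>j\<in>J \<times> K. C (i, j))"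
      by (simp add: sum.cartesian_product)
    also have "\<dots> = sum a I"
      using that by (simp add: tables_def)
    finally show "sum C (I \<times> (J \<times> K)) = int N" using assms by simp
  qed (use that assms in \<open>auto simp: tables_def PiE_def Pi_def\<close>)
  have "(\<Sum>sg | sg permutes {..<N}. fixcount N I a sg * (fixcount N J b sg * fixcount N K c sg))
    = (\<Sum>sg | sg permutes {..<N}. \<Sum>B\<in>tables J K b c. \<Sum>C\<in>tables I (J \<times> K) a B. fixcount N (I \<times> (J \<times> K)) C sg)"
    by (intro sum.cong) (auto simp: eq)
  also have "\<dots> = (\<Sum>B\<in>tables J K b c. \<Sum>sg | sg permutes {..<N}. \<Sum>C\<in>tables I (J \<times> K) a B. fixcount N (I \<times> (J \<times> K)) C sg)"
    by (rule sum.swap)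
  also have "\<dots> = (\<Sum>B\<in>tables J K b c. \<Sum>C\<in>tables I (J \<times> K) a B. \<Sum>sg | sg permutes {..<N}. fixcount N (I \<times> (J \<times> K)) C sg)"
    by (intro sum.cong refl) (rule sum.swap)
  also have "\<dots> = (\<Sum>B\<in>tables J K b c. \<Sum>C\<in>tables I (J \<times> K) a B. fact N)"
    by (intro sum.cong refl av)
  finally show ?thesis by (simp add: sum_distrib_left mult.commute)
qed

lemma sum_product3:
  fixes f :: "'a \<Rightarrow> 'r::comm_semiring_0"
  shows "sum f A * sum g B * sum h C = (\<Sum>w\<in>B. \<Sum>v\<in>C. \<Sum>u\<in>A. f u * g w * h v)"
proof -
  have "sum f A * sum g B * sum h C = sum g B * (sum h C * sum f A)"
    by (simp add: mult_ac)
  also have "sum h C * sum f A = (\<Sum>v\<in>C. \<Sum>u\<in>A. h v * f u)"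
    by (rule sum_product)
  also have "sum g B * \<dots> = (\<Sum>w\<in>B. \<Sum>v\<in>C. \<Sum>u\<in>A. g w * (h v * f u))"
    by (subst sum_distrib_right) (simp only: sum_distrib_left)
  finally show ?thesis by (simp add: mult_ac)
qed

text \<open>All three characters are expanded; the signs of \<open>lam\<close> are collected in
  \<open>kostka\<close>, those of \<open>mu\<close> and \<open>nu\<close> remain. The character sum
  comes out as \<open>fact N\<close> times an integer, so the \<open>div\<close> in
  \<open>kron\<close> is exact.\<close>

theorem kron_eq_sum_kostka:
  assumes "sum_list lam = sum_list mu" "sum_list mu = sum_list nu"
  shows "kron lam mu nu = (\<Sum>w | w permutes {..<length mu}. \<Sum>v | v permutes {..<length nu}.
    sign w * sign v * (\<Sum>B\<in>tables {..<length mu} {..<length nu} (shift (parts mu) w) (shift (parts nu) v).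
       kostka (length lam) (parts lam) ({..<length mu} \<times> {..<length nu}) B))" (is "_ = ?R")
proof -
  define N where "N = sum_list lam"
  define l p q where "l = length lam" and "p = length mu" and "q = length nu"
  define X where "X = (\<lambda>u sg. int (fixcount N {..<l} (shift (parts lam) u) sg))"
  define Y where "Y = (\<lambda>u sg. int (fixcount N {..<p} (shift (parts mu) u) sg))"
  define Z where "Z = (\<lambda>u sg. int (fixcount N {..<q} (shift (parts nu) u) sg))"
  define T where "T = (\<lambda>w v. tables {..<p} {..<q} (shift (parts mu) w) (shift (parts nu) v))"
  have "(\<Sum>sg | sg permutes {0..<N}. chi lam sg * chi mu sg * chi nu sg)
     = (\<Sum>sg | sg permutes {..<N}. (\<Sum>u | u permutes {..<l}. sign u * X u sg) *
         (\<Sum>w | w permutes {..<p}. sign w * Y w sg) * (\<Sum>v | v permutes {..<q}. sign v * Z v sg))"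
    using assms by (simp add: chi_eq X_def Y_def Z_def N_def l_def p_def q_def atLeast0LessThan)
  also have "\<dots> = (\<Sum>sg | sg permutes {..<N}. \<Sum>w | w permutes {..<p}. \<Sum>v | v permutes {..<q}. \<Sum>u | u permutes {..<l}.
      sign w * sign v * (sign u * (X u sg * (Y w sg * Z v sg))))"
    by (intro sum.cong refl, subst sum_product3) (simp add: mult_ac)
  also have "\<dots> = (\<Sum>w | w permutes {..<p}. \<Sum>v | v permutes {..<q}. \<Sum>u | u permutes {..<l}. \<Sum>sg | sg permutes {..<N}.
      sign w * sign v * (sign u * (X u sg * (Y w sg * Z v sg))))"
    by (simp only: sum.swap[of _ _ "{sg. sg permutes {..<N}}"])
  also have "\<dots> = (\<Sum>w | w permutes {..<p}. \<Sum>v | v permutes {..<q}. \<Sum>u | u permutes {..<l}.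
      sign w * sign v * (sign u * (fact N * (\<Sum>B\<in>T w v. int (card (tables {..<l} ({..<p} \<times> {..<q}) (shift (parts lam) u) B))))))"
  proof (intro sum.cong refl)
    fix u w v assume "u \<in> {u. u permutes {..<l}}"
    then have "(\<Sum>i<l. shift (parts lam) u i) = int N"
      by (simp add: sum_shift l_def sum_parts N_def)
    then have "(\<Sum>sg | sg permutes {..<N}. fixcount N {..<l} (shift (parts lam) u) sg *
        (fixcount N {..<p} (shift (parts mu) w) sg * fixcount N {..<q} (shift (parts nu) v) sg))
      = fact N * (\<Sum>B\<in>T w v. card (tables {..<l} ({..<p} \<times> {..<q}) (shift (parts lam) u) B))"
      unfolding T_def by (intro sum_fixcount3) auto
    then have "int (\<Sum>sg | sg permutes {..<N}. fixcount N {..<l} (shift (parts lam) u) sg *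
        (fixcount N {..<p} (shift (parts mu) w) sg * fixcount N {..<q} (shift (parts nu) v) sg))
      = int (fact N * (\<Sum>B\<in>T w v. card (tables {..<l} ({..<p} \<times> {..<q}) (shift (parts lam) u) B)))"
      by (rule arg_cong)
    then have "(\<Sum>sg | sg permutes {..<N}. X u sg * (Y w sg * Z v sg))
       = fact N * (\<Sum>B\<in>T w v. int (card (tables {..<l} ({..<p} \<times> {..<q}) (shift (parts lam) u) B)))"
      by (simp add: X_def Y_def Z_def)
    then show "(\<Sum>sg | sg permutes {..<N}. sign w * sign v * (sign u * (X u sg * (Y w sg * Z v sg))))
      = sign w * sign v * (sign u * (fact N * (\<Sum>B\<in>T w v. int (card (tables {..<l} ({..<p} \<times> {..<q}) (shift (parts lam) u) B)))))"
      by (simp flip: sum_distrib_left)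
  qed
  also have "\<dots> = fact N * ?R"
  proof -
    have "(\<Sum>u | u permutes {..<l}. sign w * sign v * (sign u * (fact N * (\<Sum>B\<in>T w v. int (card (tables {..<l} ({..<p} \<times> {..<q}) (shift (parts lam) u) B))))))
       = fact N * (sign w * sign v * (\<Sum>B\<in>T w v. kostka l (parts lam) ({..<p} \<times> {..<q}) B))" for w v
      unfolding kostka_def
      by (subst sum.swap) (simp add: sum_distrib_left mult_ac)
    then show ?thesis
      by (simp add: T_def l_def p_def q_def sum_distrib_left)
  qed
  finally have "(\<Sum>sg | sg permutes {0..<N}. chi lam sg * chi mu sg * chi nu sg) = fact N * ?R" .
  then show ?thesis
    using assms by (simp add: kron_def N_def)
qed

section \<open>Kostka numbers\<close>

definition weak_comps :: "'i set \<Rightarrow> int \<Rightarrow> ('i \<Rightarrow> int) set" where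
  "weak_comps I s = {d \<in> I \<rightarrow>\<^sub>E {0..}. sum d I = s}"

lemma finite_weak_comps:
  assumes "finite I"
  shows "finite (weak_comps I s)"
proof (rule finite_subset)
  have "d i \<le> s" if "d \<in> weak_comps I s" "i \<in> I" for d i
  proof -
    have "d i \<le> sum d I"
      using that assms by (intro member_le_sum) (auto simp: weak_comps_def PiE_def Pi_def)
    with that show ?thesis by (simp add: weak_comps_def)
  qed
  then show "weak_comps I s \<subseteq> I \<rightarrow>\<^sub>E {0..s}"
    by (auto simp: weak_comps_def PiE_def Pi_def)
  show "finite (I \<rightarrow>\<^sub>E {0..s})" using assms by (intro finite_PiE) auto
qed

lemma tables_cong:
  assumes "\<And>i. i \<in> I \<Longrightarrow> a i = a' i" "\<And>j. j \<in> J \<Longrightarrow> b j = b' j"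
  shows "tables I J a b = tables I J a' b'"
  using assms unfolding tables_def by auto

lemma tables_empty_if_neg:
  assumes "i \<in> I" "a i < 0"
  shows "tables I J a b = {}"
proof -
  have "False" if "B \<in> tables I J a b" for B
  proof -
    have "0 \<le> (\<Sum>j\<in>J. B (i, j))"
      using that assms by (intro sum_nonneg) (auto simp: tables_def PiE_def Pi_def)
    with that assms show False by (auto simp: tables_def)
  qed
  then show ?thesis by blast
qed

text \<open>A table is its column \<open>c\<close>, a weak composition \<open>d\<close> of
  \<open>B c\<close>, together with the other columns, whose row sums have dropped by
  \<open>d\<close>.\<close>

lemma card_tables_insert:
  assumes I: "finite I" and J: "finite J" and c: "c \<notin> J"
  shows "card (tables I (insert c J) a B) =
    (\<Sum>d\<in>weak_comps I (B c). card (tables I J (\<lambda>i. a i - d i) B))"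
proof -
  let ?S = "SIGMA d:weak_comps I (B c). tables I J (\<lambda>i. a i - d i) B"
  define \<Phi> where "\<Phi> = (\<lambda>C :: 'a \<times> 'b \<Rightarrow> int. (\<lambda>i\<in>I. C (i, c), restrict C (I \<times> J)))"
  define \<Psi> where "\<Psi> = (\<lambda>(d, C). \<lambda>(i, j)\<in>I \<times> insert c J. if j = c then d i else (C (i, j) :: int))"
  have "bij_betw \<Phi> (tables I (insert c J) a B) ?S"
  proof (rule bij_betw_byWitness[where f' = \<Psi>])
    show "\<forall>C\<in>tables I (insert c J) a B. \<Psi> (\<Phi> C) = C"
      by (auto simp: \<Phi>_def \<Psi>_def tables_def PiE_def extensional_def fun_eq_iff)
    show "\<forall>p\<in>?S. \<Phi> (\<Psi> p) = p"
      using c by (auto simp: \<Phi>_def \<Psi>_def tables_def weak_comps_def PiE_def extensional_def fun_eq_iff)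
    show "\<Phi> ` tables I (insert c J) a B \<subseteq> ?S"
      using J c by (force simp: \<Phi>_def tables_def weak_comps_def PiE_def Pi_def intro!: sum.cong)
    show "\<Psi> ` ?S \<subseteq> tables I (insert c J) a B"
    proof safe
      fix d C assume d: "d \<in> weak_comps I (B c)" and C: "C \<in> tables I J (\<lambda>i. a i - d i) B"
      have 1: "(\<Sum>j\<in>insert c J. \<Psi> (d, C) (i, j)) = a i" if "i \<in> I" for i
      proof -
        have "(\<Sum>j\<in>J. \<Psi> (d, C) (i, j)) = (\<Sum>j\<in>J. C (i, j))"
          using c that by (intro sum.cong) (auto simp: \<Psi>_def)
        then show ?thesis using J c C that by (simp add: tables_def \<Psi>_def)
      qed
      have 2: "(\<Sum>i\<in>I. \<Psi> (d, C) (i, j)) = B j" if "j \<in> insert c J" for j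
      proof (cases "j = c")
        case True
        then have "(\<Sum>i\<in>I. \<Psi> (d, C) (i, j)) = sum d I"
          by (intro sum.cong) (auto simp: \<Psi>_def)
        then show ?thesis using d True by (simp add: weak_comps_def)
      next
        case False
        then have "(\<Sum>i\<in>I. \<Psi> (d, C) (i, j)) = (\<Sum>i\<in>I. C (i, j))"
          using that by (intro sum.cong) (auto simp: \<Psi>_def)
        then show ?thesis using C False that by (simp add: tables_def)
      qed
      have 3: "\<Psi> (d, C) \<in> I \<times> insert c J \<rightarrow>\<^sub>E {0..}"
        using d C by (auto simp: \<Psi>_def tables_def weak_comps_def PiE_def Pi_def)
      show "\<Psi> (d, C) \<in> tables I (insert c J) a B"
        unfolding tables_def using 1 2 3 by blast
    qed
  qed
  then have "card (tables I (insert c J) a B) = card ?S"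
    by (rule bij_betw_same_card)
  also have "\<dots> = (\<Sum>d\<in>weak_comps I (B c). card (tables I J (\<lambda>i. a i - d i) B))"
    using I J by (intro card_SigmaI finite_weak_comps ballI finite_tables)
  finally show ?thesis .
qed

lemma card_tables_permute:
  assumes s: "s permutes I"
  shows "card (tables I J (\<lambda>i. a (s i)) B) = card (tables I J a B)"
proof -
  define \<Phi> where "\<Phi> = (\<lambda>t C. \<lambda>(i, j)\<in>I \<times> J. (C (t i :: 'a, j :: 'b) :: int))"
  have si: "inv s permutes I" using s by (rule permutes_inv)
  have maps: "\<Phi> t ` tables I J a B \<subseteq> tables I J (\<lambda>i. a (t i)) B" if t: "t permutes I" for t a
  proof safe
    fix C assume C: "C \<in> tables I J a B"
    have tI: "t i \<in> I \<longleftrightarrow> i \<in> I" for i using permutes_in_image[OF t] .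
    have "(\<Sum>i\<in>I. C (t i, j)) = (\<Sum>i\<in>I. C (i, j))" for j
      using sum.permute[OF t, of "\<lambda>i. C (i, j)"] by (simp add: o_def)
    then show "\<Phi> t C \<in> tables I J (\<lambda>i. a (t i)) B"
      using C tI by (auto simp: \<Phi>_def tables_def PiE_def Pi_def)
  qed
  have "bij_betw (\<Phi> s) (tables I J a B) (tables I J (\<lambda>i. a (s i)) B)"
  proof (rule bij_betw_byWitness[where f' = "\<Phi> (inv s)"])
    show "\<Phi> (inv s) ` tables I J (\<lambda>i. a (s i)) B \<subseteq> tables I J a B"
      using maps[OF si, of "\<lambda>i. a (s i)"] s by (simp add: permutes_inverses)
    show "\<forall>C\<in>tables I J a B. \<Phi> (inv s) (\<Phi> s C) = C"
      using s permutes_in_image[OF si]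
      by (auto simp: \<Phi>_def tables_def PiE_def extensional_def fun_eq_iff permutes_inverses)
    show "\<forall>C\<in>tables I J (\<lambda>i. a (s i)) B. \<Phi> s (\<Phi> (inv s) C) = C"
      using s permutes_in_image[OF s]
      by (auto simp: \<Phi>_def tables_def PiE_def extensional_def fun_eq_iff permutes_inverses)
  qed (rule maps[OF s])
  then show ?thesis by (metis bij_betw_same_card)
qed

section \<open>Straightening and the branching rule\<close>

lemma kostka_cong:
  assumes "\<And>i. i < l \<Longrightarrow> f i = g i" "\<And>j. j \<in> J \<Longrightarrow> B j = C j"
  shows "kostka l f J B = kostka l g J C"
proof -
  have "tables {..<l} J (shift f u) B = tables {..<l} J (shift g u) C" for u
    using assms by (intro tables_cong) (auto simp: shift_def)
  then show ?thesis by (simp add: kostka_def)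
qed

lemma kostka_insert_weak_comps:
  assumes J: "finite J" and c: "c \<notin> J"
  shows "kostka l f (insert c J) B = (\<Sum>d\<in>weak_comps {..<l} (B c). kostka l (\<lambda>i. f i - d i) J B)"
proof -
  have eq: "shift (\<lambda>i. f i - d i) u = (\<lambda>i. shift f u i - d i)" for d u
    by (simp add: shift_def fun_eq_iff)
  have "kostka l f (insert c J) B = (\<Sum>u | u permutes {..<l}. \<Sum>d\<in>weak_comps {..<l} (B c).
      sign u * int (card (tables {..<l} J (shift (\<lambda>i. f i - d i) u) B)))"
    using J c by (simp add: kostka_def card_tables_insert sum_distrib_left eq)
  also have "\<dots> = (\<Sum>d\<in>weak_comps {..<l} (B c). kostka l (\<lambda>i. f i - d i) J B)"
    unfolding kostka_def by (rule sum.swap)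
  finally show ?thesis .
qed

text \<open>In terms of f i - i the hypotheses exchange the entries i and i + 1, that is, two rows
  of the determinant.\<close>

lemma kostka_swap:
  assumes i: "Suc i < l"
    and g: "g i = f (Suc i) - 1" "g (Suc i) = f i + 1" "\<And>j. j \<noteq> i \<Longrightarrow> j \<noteq> Suc i \<Longrightarrow> g j = f j"
  shows "kostka l g J B = - kostka l f J B"
proof -
  define s where "s = Transposition.transpose i (Suc i)"
  have s: "s permutes {..<l}" unfolding s_def using i by (intro permutes_swap_id) auto
  have ss: "s (s j) = j" for j by (simp add: s_def)
  have sgn: "sign (u \<circ> s) = - sign u" if "u permutes {..<l}" for u
  proof -
    have "permutation u" "permutation s"
      using that s by (auto intro: permutes_imp_permutation[of "{..<l}"])
    then show ?thesis by (simp add: sign_compose s_def sign_swap_id)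
  qed
  have sh: "shift g u = (\<lambda>j. shift f (u \<circ> s) (s j))" for u
  proof
    fix j
    consider "j = i" | "j = Suc i" | "j \<noteq> i" "j \<noteq> Suc i" by blast
    then show "shift g u j = shift f (u \<circ> s) (s j)"
      by cases (use g in \<open>auto simp: shift_def s_def transpose_def\<close>)
  qed
  have "kostka l g J B = (\<Sum>u | u permutes {..<l}. sign u * int (card (tables {..<l} J (shift f (u \<circ> s)) B)))"
    unfolding kostka_def sh using card_tables_permute[OF s, of J _ B] by simp
  also have "\<dots> = (\<Sum>u | u permutes {..<l}. sign (u \<circ> s) * int (card (tables {..<l} J (shift f (u \<circ> s \<circ> s)) B)))"
    by (rule sum_permutations_compose_right[OF s])
  also have "\<dots> = (\<Sum>u | u permutes {..<l}. - (sign u * int (card (tables {..<l} J (shift f u) B))))"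
  proof (intro sum.cong refl)
    fix u assume "u \<in> {u. u permutes {..<l}}"
    moreover have "u \<circ> s \<circ> s = u" using ss by (simp add: fun_eq_iff)
    ultimately show "sign (u \<circ> s) * int (card (tables {..<l} J (shift f (u \<circ> s \<circ> s)) B))
        = - (sign u * int (card (tables {..<l} J (shift f u) B)))"
      by (simp only: sgn mem_Collect_eq mult_minus_left)
  qed
  finally show ?thesis by (simp add: kostka_def sum_negf)
qed

text \<open>Values of \<open>u\<close> are at most l - 1, so every index in the last row of the
  determinant is negative.\<close>

lemma kostka_eq_0_if_neg:
  assumes "0 < l" "f (l - 1) < 0"
  shows "kostka l f J B = 0"
proof -
  have "tables {..<l} J (shift f u) B = {}" if "u permutes {..<l}" for u
  proof (rule tables_empty_if_neg[of "l - 1"])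
    have "u (l - 1) < l" using permutes_in_image[OF that, of "l - 1"] assms by auto
    then show "shift f u (l - 1) < 0" using assms by (simp add: shift_def)
  qed (use assms in auto)
  then show ?thesis by (simp add: kostka_def)
qed

text \<open>Padding with zeros over all natural numbers gives the last row a successor to be
  compared with. The type is open because integers serve for Kostka numbers and reals for the
  cone.\<close>

definition partition_fun :: "nat \<Rightarrow> (nat \<Rightarrow> 'a::linordered_idom) \<Rightarrow> bool" where
  "partition_fun l f \<longleftrightarrow> (\<forall>i. f (Suc i) \<le> f i) \<and> (\<forall>i\<ge>l. f i = 0)"

lemma partition_antimono: "partition_fun l f \<Longrightarrow> i \<le> j \<Longrightarrow> f j \<le> f i"
  unfolding partition_fun_def by (metis lift_Suc_antimono_le)

lemma partition_nonneg: "partition_fun l f \<Longrightarrow> f i \<ge> 0"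
  using partition_antimono[of l f i "max i l"] by (auto simp: partition_fun_def)

definition hstrips :: "nat \<Rightarrow> (nat \<Rightarrow> int) \<Rightarrow> int \<Rightarrow> (nat \<Rightarrow> int) set" where
  "hstrips l f s = {g. (\<forall>i. f (Suc i) \<le> g i \<and> g i \<le> f i) \<and> (\<Sum>i<l. g i) = (\<Sum>i<l. f i) - s}"

lemma hstrips_partition:
  assumes "partition_fun l f" "g \<in> hstrips l f s"
  shows "partition_fun l g"
  unfolding partition_fun_def
proof (intro conjI allI impI)
  have le: "f (Suc i) \<le> g i" "g i \<le> f i" for i using assms by (auto simp: hstrips_def)
  show "g (Suc i) \<le> g i" for i using le(1)[of i] le(2)[of "Suc i"] by simp
  show "g i = 0" if "l \<le> i" for i
    using le[of i] assms(1) that by (simp add: partition_fun_def)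
qed

text \<open>If \<open>d\<close> does not remove a horizontal strip, let \<open>i\<close> be least with \<open>f i - d i < f (i + 1)\<close>;
  exchanging the (shifted) rows \<open>i\<close> and \<open>i + 1\<close> of \<open>f - d\<close> is a sign-reversing involution.\<close>
lemma sum_kostka_bad_eq_0:
  fixes f :: "nat \<Rightarrow> int"
  assumes f: "\<And>i. f (Suc i) \<le> f i"
  shows "(\<Sum>d | d \<in> weak_comps {..<l} s \<and> (\<exists>i. Suc i < l \<and> f i - d i < f (Suc i)).
     kostka l (\<lambda>i. f i - d i) J B) = 0" (is "sum ?h ?Bad = 0")
proof -
  define bad where "bad = (\<lambda>d i. Suc i < l \<and> f i - d i < f (Suc i))"
  define k where "k d = (LEAST i. bad d i)" for d
  \<comment> \<open>Solved from the exchange in \<open>kostka_swap\<close>: f - t d takes the value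
    f (i + 1) - d (i + 1) - 1 at i and f i - d i + 1 at i + 1.\<close>
  define t where "t d = (let i = k d in
     d(i := f i - f (Suc i) + d (Suc i) + 1, Suc i := f (Suc i) - f i + d i - 1))" for d
  have Bad: "d \<in> ?Bad \<longleftrightarrow> d \<in> weak_comps {..<l} s \<and> (\<exists>i. bad d i)" for d
    by (auto simp: bad_def)
  have kb: "bad d (k d)" if "d \<in> ?Bad" for d
    using that unfolding Bad k_def by (auto intro: LeastI_ex)
  have tk: "k (t d) = k d" if d: "d \<in> ?Bad" for d
  proof -
    let ?i = "k d"
    have "bad (t d) ?i"
    proof -
      have "0 \<le> d (Suc ?i)"
        using d kb[OF d] by (auto simp: weak_comps_def bad_def PiE_def Pi_def)
      then show ?thesis using kb[OF d] by (simp add: t_def Let_def bad_def)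
    qed
    \<comment> \<open>Badness at j involves only the entry \<open>d j\<close>, and \<open>t\<close>
      leaves the entries before the least bad position alone. Hence that position is preserved,
      which makes \<open>t\<close> an involution.\<close>
    moreover have "\<not> bad (t d) j" if "j < ?i" for j
      using not_less_Least[of j "bad d"] that by (simp add: bad_def t_def Let_def k_def)
    ultimately show ?thesis
      unfolding k_def[of "t d"] by (intro Least_equality) (auto simp: not_less[symmetric])
  qed
  have tt: "t (t d) = d" if d: "d \<in> ?Bad" for d
    unfolding t_def[of "t d"] Let_def tk[OF d] by (auto simp: t_def Let_def fun_eq_iff)
  have tB: "t d \<in> ?Bad" if d: "d \<in> ?Bad" for d
  proof -
    let ?i = "k d"
    have i: "Suc ?i < l" "f ?i - d ?i < f (Suc ?i)" using kb[OF d] by (auto simp: bad_def)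
    have pos: "0 \<le> d j" if "j < l" for j
      using d that by (auto simp: weak_comps_def PiE_def Pi_def)
    have "sum (t d) {..<l} = sum d {..<l}"
    proof -
      have split: "sum g {..<l} = g ?i + (g (Suc ?i) + sum g ({..<l} - {?i} - {Suc ?i}))" for g :: "nat \<Rightarrow> int"
        using i by (simp add: sum.remove[of "{..<l}" ?i] sum.remove[of "{..<l} - {?i}" "Suc ?i"])
      have "sum (t d) ({..<l} - {?i} - {Suc ?i}) = sum d ({..<l} - {?i} - {Suc ?i})"
        by (intro sum.cong) (auto simp: t_def Let_def)
      then show ?thesis unfolding split[of d] split[of "t d"] by (simp add: t_def Let_def)
    qed
    \<comment> \<open>The entry at i is nonnegative because \<open>f\<close> decreases, the one at i
      + 1 because \<open>d\<close> is bad at i.\<close>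
    moreover have "t d \<in> {..<l} \<rightarrow>\<^sub>E {0..}"
      using d i f[of ?i] pos[of ?i] pos[of "Suc ?i"]
      by (auto simp: t_def Let_def weak_comps_def PiE_def Pi_def extensional_def)
    ultimately have "t d \<in> weak_comps {..<l} s" using d by (simp add: weak_comps_def)
    moreover have "bad (t d) ?i"
      using i pos[of "Suc ?i"] by (simp add: bad_def t_def Let_def)
    ultimately show ?thesis unfolding Bad by blast
  qed
  have neg: "?h (t d) = - ?h d" if d: "d \<in> ?Bad" for d
    using kb[OF d] by (intro kostka_swap[of "k d"]) (auto simp: bad_def t_def Let_def)
  have "sum ?h ?Bad = (\<Sum>d\<in>?Bad. - ?h d)"
    using tt tB neg by (intro sum.reindex_bij_witness[of _ t t]) auto
  then show ?thesis by (simp add: sum_negf)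
qed

text \<open>Among the possible columns \<open>d\<close> the bad ones cancel in pairs, and those
  overdrawing the last row contribute zero. What remains is the removal of horizontal
  strips.\<close>

theorem kostka_branching:
  assumes f: "partition_fun l f" and J: "finite J" and c: "c \<notin> J"
  shows "kostka l f (insert c J) B = (\<Sum>g\<in>hstrips l f (B c). kostka l g J B)"
proof -
  let ?W = "weak_comps {..<l} (B c)"
  let ?h = "\<lambda>d. kostka l (\<lambda>i. f i - d i) J B"
  define Bad where "Bad = {d \<in> ?W. \<exists>i. Suc i < l \<and> f i - d i < f (Suc i)}"
  \<comment> \<open>The last row has no row below it to be exchanged with. Since f l = 0, violating
    the strip condition there means a negative last entry.\<close>
  define Neg where "Neg = {d \<in> ?W - Bad. 0 < l \<and> f (l - 1) - d (l - 1) < 0}"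
  define Good where "Good = {d \<in> ?W. \<forall>i<l. f (Suc i) \<le> f i - d i}"
  have f0: "f i = 0" if "l \<le> i" for i using f that by (simp add: partition_fun_def)
  have sub: "\<And>d. d \<in> ?W \<Longrightarrow> d \<notin> Bad \<Longrightarrow> d \<notin> Neg \<Longrightarrow> d \<in> Good"
  proof -
    fix d assume d: "d \<in> ?W" "d \<notin> Bad" "d \<notin> Neg"
    have "f (Suc i) \<le> f i - d i" if "i < l" for i
    proof (cases "Suc i < l")
      case True
      then show ?thesis using d(1,2) unfolding Bad_def by force
    next
      case False
      then have "Suc i = l" using that by simp
      then show ?thesis using d f0[of l] by (auto simp: Neg_def not_less)
    qed
    then show "d \<in> Good" using d by (simp add: Good_def)
  qed
  have split: "?W = Bad \<union> (Neg \<union> Good)" "Bad \<inter> (Neg \<union> Good) = {}" "Neg \<inter> Good = {}"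
  proof -
    show "?W = Bad \<union> (Neg \<union> Good)" using sub by (auto simp: Bad_def Neg_def Good_def)
    have "Bad \<inter> Good = {}" by (auto simp: Bad_def Good_def) (meson Suc_lessD not_less)
    then show "Bad \<inter> (Neg \<union> Good) = {}" by (auto simp: Neg_def)
    have False if d: "d \<in> Neg" "d \<in> Good" for d
    proof -
      have "0 < l" "f (l - 1) - d (l - 1) < 0" using d by (auto simp: Neg_def)
      moreover from this have "f (Suc (l - 1)) \<le> f (l - 1) - d (l - 1)"
        using d(2) unfolding Good_def by (metis (mono_tags, lifting) diff_less mem_Collect_eq zero_less_one)
      ultimately show False using f0[of l] by simp
    qed
    then show "Neg \<inter> Good = {}" by blast
  qed
  have fin: "finite Bad" "finite Neg" "finite Good"
    using finite_weak_comps[of "{..<l}" "B c"] by (auto simp: Bad_def Neg_def Good_def)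
  have "kostka l f (insert c J) B = sum ?h ?W"
    using J c by (rule kostka_insert_weak_comps)
  also have "\<dots> = sum ?h Bad + (sum ?h Neg + sum ?h Good)"
    using fin split by (simp add: sum.union_disjoint)
  also have "sum ?h Bad = 0"
    unfolding Bad_def using f by (intro sum_kostka_bad_eq_0) (simp add: partition_fun_def)
  also have "sum ?h Neg = 0"
    by (intro sum.neutral ballI kostka_eq_0_if_neg) (auto simp: Neg_def)
  also have "sum ?h Good = (\<Sum>g\<in>hstrips l f (B c). kostka l g J B)"
  proof (rule sum.reindex_bij_witness[of _ "\<lambda>g. \<lambda>i\<in>{..<l}. f i - g i" "\<lambda>d i. if i < l then f i - d i else 0"])
    fix g assume g: "g \<in> hstrips l f (B c)"
    then have pg: "partition_fun l g" by (rule hstrips_partition[OF f])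
    then show "(\<lambda>i. if i < l then f i - (\<lambda>i\<in>{..<l}. f i - g i) i else 0) = g"
      by (auto simp: partition_fun_def fun_eq_iff)
    show "(\<lambda>i\<in>{..<l}. f i - g i) \<in> Good"
      using g by (auto simp: Good_def weak_comps_def hstrips_def sum_subtractf)
  next
    fix d assume d: "d \<in> Good"
    then show "(\<lambda>i\<in>{..<l}. f i - (if i < l then f i - d i else 0)) = d"
      by (auto simp: Good_def weak_comps_def PiE_def extensional_def fun_eq_iff)
    show "(\<lambda>i. if i < l then f i - d i else 0) \<in> hstrips l f (B c)"
      using d f0 by (auto simp: Good_def weak_comps_def hstrips_def sum_subtractf PiE_def Pi_def)
    show "kostka l (\<lambda>i. if i < l then f i - d i else 0) J B = ?h d"
      by (intro kostka_cong) auto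
  qed
  finally show ?thesis by simp
qed

lemma finite_hstrips:
  assumes "partition_fun l f"
  shows "finite (hstrips l f s)"
proof (rule finite_subset)
  show "hstrips l f s \<subseteq> {g. \<forall>i. (i \<in> {..<l} \<longrightarrow> g i \<in> {0..f 0}) \<and> (i \<notin> {..<l} \<longrightarrow> g i = 0)}"
  proof clarify
    fix g i assume g: "g \<in> hstrips l f s"
    then have "partition_fun l g" using assms hstrips_partition by blast
    moreover have "g i \<le> f 0"
      using g partition_antimono[OF assms, of 0 i] by (auto simp: hstrips_def intro: order_trans)
    ultimately show "(i \<in> {..<l} \<longrightarrow> g i \<in> {0..f 0}) \<and> (i \<notin> {..<l} \<longrightarrow> g i = 0)"
      using partition_nonneg[of l g i] by (auto simp: partition_fun_def)
  qed
qed (rule finite_set_of_finite_funs; simp)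

text \<open>Without columns all shifted row sums must vanish. Then u i = i - f i \<le> i for i < l,
  which leaves only the identity.\<close>

lemma kostka_empty:
  assumes f: "partition_fun l f"
  shows "kostka l f {} B = (if \<forall>i. f i = 0 then 1 else 0)"
proof -
  have f0: "(\<forall>i. f i = 0) \<longleftrightarrow> (\<forall>i<l. f i = 0)"
    using f by (meson not_less partition_fun_def)
  have t: "card (tables {..<l} {} a B) = (if \<forall>i<l. a i = 0 then 1 else 0)" for a
    by (auto simp: tables_def)
  have eq: "(\<forall>i<l. shift f u i = 0) \<longleftrightarrow> u = id \<and> (\<forall>i<l. f i = 0)" if u: "u permutes {..<l}" for u
  proof
    assume *: "\<forall>i<l. shift f u i = 0"
    have "u i \<le> i" if "i < l" for i
      using * that partition_nonneg[OF f, of i] by (auto simp: shift_def)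
    then have "u = id" using u by (intro permutes_natset_le) auto
    with * show "u = id \<and> (\<forall>i<l. f i = 0)" by (simp add: shift_def)
  qed (simp add: shift_def)
  have "kostka l f {} B = (\<Sum>u | u permutes {..<l}. if u = id \<and> (\<forall>i<l. f i = 0) then 1 else 0)"
    unfolding kostka_def t by (intro sum.cong) (auto simp: eq)
  also have "\<dots> = (if \<forall>i<l. f i = 0 then 1 else 0)"
  proof (cases "\<forall>i<l. f i = 0")
    case True
    then show ?thesis by (simp add: finite_permutations permutes_id)
  next
    case False
    then show ?thesis by (simp only: simp_thms if_False sum.neutral_const)
  qed
  finally show ?thesis using f0 by simp
qed

section \<open>Dominance, along an arbitrary enumeration of the columns\<close>

lemma kostka_enum_Suc:
  assumes "partition_fun l f" "inj_on e {..<Suc r}"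
  shows "kostka l f (e ` {..<Suc r}) B = (\<Sum>g\<in>hstrips l f (B (e r)). kostka l g (e ` {..<r}) B)"
proof -
  have "e r \<notin> e ` {..<r}"
  proof
    assume "e r \<in> e ` {..<r}"
    then obtain t where t: "t < r" "e r = e t" by auto
    with inj_onD[OF assms(2) t(2)] show False by simp
  qed
  then show ?thesis using kostka_branching[OF assms(1), of "e ` {..<r}" "e r" B]
    by (simp add: lessThan_Suc)
qed

lemma partition_sum_eq:
  assumes "partition_fun l f" "\<And>i. r \<le> i \<Longrightarrow> f i = 0"
  shows "(\<Sum>i<l. f i) = (\<Sum>i<r. f i)"
proof -
  have "(\<Sum>i<l. f i) = (\<Sum>i<max l r. f i)" "(\<Sum>i<r. f i) = (\<Sum>i<max l r. f i)"
    using assms by (auto intro!: sum.mono_neutral_left simp: partition_fun_def) (meson not_less)+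
  then show ?thesis by simp
qed

text \<open>Induction along the branching rule: the function left after removing the last column
  lies below \<open>f\<close>, so its partial sums pass the bound on, and the total is preserved.
  The inequalities hold for every enumeration \<open>e\<close>, so the order can later be chosen by
  the weights.\<close>

lemma kostka_nonzeroD:
  assumes "partition_fun l f" "inj_on e {..<r}" "kostka l f (e ` {..<r}) B \<noteq> 0"
  shows "(\<forall>i\<ge>r. f i = 0) \<and> (\<forall>s\<le>r. (\<Sum>t<s. B (e t)) \<le> (\<Sum>t<s. f t)) \<and>
    (\<Sum>t<r. B (e t)) = (\<Sum>t<r. f t)"
  using assms
proof (induction r arbitrary: f)
  case 0
  then show ?case by (auto simp: kostka_empty split: if_splits)
next
  case (Suc r)
  have inj: "inj_on e {..<r}" using Suc.prems(2) by (rule inj_on_subset) auto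
  obtain g where g: "g \<in> hstrips l f (B (e r))" and nz: "kostka l g (e ` {..<r}) B \<noteq> 0"
    using Suc.prems(3) kostka_enum_Suc[OF Suc.prems(1,2), of B] by (auto elim: sum.not_neutral_contains_not_neutral)
  have pg: "partition_fun l g" using Suc.prems(1) g by (rule hstrips_partition)
  note IH = Suc.IH[OF pg inj nz]
  have le: "f (Suc i) \<le> g i" "g i \<le> f i" for i using g by (auto simp: hstrips_def)
  have f0: "f i = 0" if "Suc r \<le> i" for i
  proof -
    obtain j where "i = Suc j" "r \<le> j" using \<open>Suc r \<le> i\<close> Suc_le_D by force
    then show ?thesis using le(1)[of j] IH partition_nonneg[OF Suc.prems(1), of i] by auto
  qed
  have total: "(\<Sum>t<Suc r. B (e t)) = (\<Sum>t<Suc r. f t)"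
  proof -
    have "(\<Sum>t<Suc r. f t) = (\<Sum>i<l. f i)"
      using partition_sum_eq[OF Suc.prems(1) f0] by simp
    also have "\<dots> = (\<Sum>i<l. g i) + B (e r)" using g by (simp add: hstrips_def)
    also have "(\<Sum>i<l. g i) = (\<Sum>i<r. g i)" using partition_sum_eq[OF pg] IH by simp
    finally show ?thesis using IH by simp
  qed
  have "(\<Sum>t<s. B (e t)) \<le> (\<Sum>t<s. f t)" if "s \<le> Suc r" for s
  proof (cases "s = Suc r")
    case False
    then have "(\<Sum>t<s. B (e t)) \<le> (\<Sum>t<s. g t)" using IH that by simp
    also have "\<dots> \<le> (\<Sum>t<s. f t)" using le by (intro sum_mono)
    finally show ?thesis .
  qed (use total in simp)
  then show ?case using f0 total by auto
qed

text \<open>Dominance forces the removed strip to be the whole last row: a contributing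
  \<open>h\<close> lies below \<open>f\<close> and has the same sum over the first \<open>r\<close>
  rows.\<close>

lemma kostka_self:
  assumes "partition_fun l f" "inj_on e {..<r}" "\<And>i. r \<le> i \<Longrightarrow> f i = 0" "\<And>t. t < r \<Longrightarrow> B (e t) = f t"
  shows "kostka l f (e ` {..<r}) B = 1"
  using assms
proof (induction r arbitrary: f)
  case 0
  then show ?case by (simp add: kostka_empty)
next
  case (Suc r)
  note f = Suc.prems(1)
  have inj: "inj_on e {..<r}" using Suc.prems(2) by (rule inj_on_subset) auto
  define g where "g = (\<lambda>i. if i < r then f i else 0)"
  have pg: "partition_fun l g"
    using f partition_nonneg[OF f] by (auto simp: partition_fun_def g_def)
  have g: "g \<in> hstrips l f (B (e r))"
  proof -
    have "f (Suc i) \<le> g i \<and> g i \<le> f i" for i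
      using Suc.prems(3)[of "Suc i"] f partition_nonneg[OF f, of i] by (auto simp: partition_fun_def g_def)
    moreover have "(\<Sum>i<l. g i) = (\<Sum>i<r. g i)" by (rule partition_sum_eq[OF pg]) (simp add: g_def)
    moreover have "(\<Sum>i<l. f i) = (\<Sum>i<Suc r. f i)" by (rule partition_sum_eq[OF f]) (rule Suc.prems(3))
    ultimately show ?thesis using Suc.prems(4)[of r] by (simp add: hstrips_def g_def)
  qed
  have uniq: "h = g" if h: "h \<in> hstrips l f (B (e r))" and nz: "kostka l h (e ` {..<r}) B \<noteq> 0" for h
  proof
    fix i
    have ph: "partition_fun l h" using f h by (rule hstrips_partition)
    note D = kostka_nonzeroD[OF ph inj nz]
    have le: "h i \<le> f i" for i using h by (auto simp: hstrips_def)
    have "(\<Sum>t<r. h t) = (\<Sum>t<r. f t)" using D Suc.prems(4) by simp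
    then have "(\<Sum>t<r. f t - h t) = 0" by (simp add: sum_subtractf)
    then have "\<forall>t<r. f t - h t = 0"
      using sum_nonneg_eq_0_iff[of "{..<r}" "\<lambda>t. f t - h t"] le by simp
    then show "h i = g i" using D by (auto simp: g_def)
  qed
  have "kostka l f (e ` {..<Suc r}) B = (\<Sum>h\<in>hstrips l f (B (e r)). kostka l h (e ` {..<r}) B)"
    by (rule kostka_enum_Suc[OF f Suc.prems(2)])
  also have "\<dots> = (\<Sum>h\<in>{g}. kostka l h (e ` {..<r}) B)"
    using g uniq by (intro sum.mono_neutral_right finite_hstrips[OF f]) auto
  also have "\<dots> = 1"
    using Suc.IH[OF pg inj] Suc.prems(4) by (simp add: g_def)
  finally show ?case .
qed

section \<open>Stability of Kostka numbers\<close>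

definition ev_const :: "(nat \<Rightarrow> 'a) \<Rightarrow> bool" where
  "ev_const h \<longleftrightarrow> (\<exists>c. \<forall>\<^sub>F k in sequentially. h k = c)"

definition ev_decided :: "(nat \<Rightarrow> bool) \<Rightarrow> bool" where
  "ev_decided P \<longleftrightarrow> eventually P sequentially \<or> (\<forall>\<^sub>F k in sequentially. \<not> P k)"

lemma ev_const_const [simp]: "ev_const (\<lambda>_. c)"
  by (auto simp: ev_const_def)

lemma ev_const_cong:
  assumes "\<forall>\<^sub>F k in sequentially. h k = g k"
  shows "ev_const h \<longleftrightarrow> ev_const g"
proof -
  have "(\<forall>\<^sub>F k in sequentially. h k = c) \<longleftrightarrow> (\<forall>\<^sub>F k in sequentially. g k = c)" for c
    by (rule eventually_subst) (use assms in \<open>auto elim: eventually_mono\<close>)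
  then show ?thesis by (simp add: ev_const_def)
qed

lemma ev_const_add:
  fixes h g :: "nat \<Rightarrow> int"
  assumes "ev_const h" "ev_const g"
  shows "ev_const (\<lambda>k. h k + g k)"
proof -
  from assms obtain c d where "\<forall>\<^sub>F k in sequentially. h k = c" "\<forall>\<^sub>F k in sequentially. g k = d"
    by (auto simp: ev_const_def)
  then have "\<forall>\<^sub>F k in sequentially. h k + g k = c + d" by eventually_elim simp
  then show ?thesis by (auto simp: ev_const_def)
qed

lemma ev_const_mult:
  fixes h :: "nat \<Rightarrow> int"
  assumes "ev_const h"
  shows "ev_const (\<lambda>k. c * h k)"
  using assms by (auto simp: ev_const_def elim: eventually_mono)

lemma ev_const_sum:
  fixes h :: "'b \<Rightarrow> nat \<Rightarrow> int"
  assumes "\<And>x. x \<in> X \<Longrightarrow> ev_const (h x)"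
  shows "ev_const (\<lambda>k. \<Sum>x\<in>X. h x k)"
  using assms by (induction X rule: infinite_finite_induct) (auto intro!: ev_const_add)

text \<open>Constancy of \<open>h\<close> is asked for only if \<open>P\<close> holds eventually: in
  \<open>kostka_stable\<close> it comes from an induction hypothesis that applies only once the
  strip condition makes the smaller function a partition.\<close>

lemma ev_const_if:
  assumes "ev_decided P" "eventually P sequentially \<Longrightarrow> ev_const h"
  shows "ev_const (\<lambda>k. if P k then h k else 0 :: int)"
  using assms(1) unfolding ev_decided_def
proof
  assume P: "eventually P sequentially"
  then have "\<forall>\<^sub>F k in sequentially. (if P k then h k else 0) = h k" by eventually_elim simp
  from ev_const_cong[OF this] assms(2)[OF P] show ?thesis by simp
next
  assume "\<forall>\<^sub>F k in sequentially. \<not> P k"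
  then have "\<forall>\<^sub>F k in sequentially. (if P k then h k else 0) = 0" by eventually_elim simp
  then show ?thesis unfolding ev_const_def by blast
qed

lemma ev_decided_cong:
  assumes "\<forall>\<^sub>F k in sequentially. P k \<longleftrightarrow> Q k" "ev_decided Q"
  shows "ev_decided P"
  using assms(2) unfolding ev_decided_def
proof
  assume "eventually Q sequentially"
  then have "eventually P sequentially" using assms(1) by eventually_elim simp
  then show "eventually P sequentially \<or> (\<forall>\<^sub>F k in sequentially. \<not> P k)" ..
next
  assume "\<forall>\<^sub>F k in sequentially. \<not> Q k"
  then have "\<forall>\<^sub>F k in sequentially. \<not> P k" using assms(1) by eventually_elim simp
  then show "eventually P sequentially \<or> (\<forall>\<^sub>F k in sequentially. \<not> P k)" ..
qed

lemma ev_decided_conj: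
  assumes "ev_decided P" "ev_decided Q"
  shows "ev_decided (\<lambda>k. P k \<and> Q k)"
proof -
  have "(\<forall>\<^sub>F k in sequentially. \<not> (P k \<and> Q k))"
    if "(\<forall>\<^sub>F k in sequentially. \<not> P k) \<or> (\<forall>\<^sub>F k in sequentially. \<not> Q k)"
    using that by (rule disjE) (erule eventually_mono, blast)+
  moreover have "\<forall>\<^sub>F k in sequentially. P k \<and> Q k"
    if "eventually P sequentially" "eventually Q sequentially"
    using that by eventually_elim simp
  ultimately show ?thesis using assms unfolding ev_decided_def by argo
qed

lemma ev_decided_Ball:
  assumes "finite X" "\<And>x. x \<in> X \<Longrightarrow> ev_decided (P x)"
  shows "ev_decided (\<lambda>k. \<forall>x\<in>X. P x k)"
  using assms
proof (induction X rule: finite_induct)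
  case empty
  then show ?case by (simp add: ev_decided_def)
next
  case (insert x F)
  have "ev_decided (\<lambda>k. P x k \<and> (\<forall>x\<in>F. P x k))"
    by (intro ev_decided_conj insert) (auto intro: insert.prems)
  then show ?case by simp
qed

text \<open>Different integer slopes differ by at least 1, so the thresholds can be read off from
  the constant terms.\<close>

lemma ev_decided_linear_le: "ev_decided (\<lambda>k. a + int k * b \<le> c + int k * d)"
proof (cases "b \<le> d")
  case True
  show ?thesis
  proof (cases "b = d")
    case False
    have "a + int k * b \<le> c + int k * d" if "k \<ge> nat (a - c)" for k
    proof -
      have "a - c \<le> int k * 1" using that by simp
      also have "\<dots> \<le> int k * (d - b)" using True False by (intro mult_left_mono) auto
      finally show ?thesis by (simp add: algebra_simps)
    qed
    then show ?thesis unfolding ev_decided_def eventually_sequentially by blast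
  qed (auto simp: ev_decided_def)
next
  case False
  have "\<not> a + int k * b \<le> c + int k * d" if "k \<ge> nat (c - a + 1)" for k
  proof -
    have "c - a < int k * 1" using that by simp
    also have "\<dots> \<le> int k * (b - d)" using False by (intro mult_left_mono) auto
    finally show ?thesis by (simp add: algebra_simps)
  qed
  then show ?thesis unfolding ev_decided_def eventually_sequentially by blast
qed

lemma ev_decided_linear_eq: "ev_decided (\<lambda>k. a + int k * b = c + int k * d)"
  using ev_decided_conj[OF ev_decided_linear_le[of a b c d] ev_decided_linear_le[of c d a b]]
  by (simp add: order_eq_iff)

text \<open>For fixed \<open>g\<close> and \<open>mu\<close> membership is a conjunction of
  conditions affine in k. From \<open>max l r\<close> on the interlacing inequalities compare zeros,
  so finitely many conditions remain.\<close>

lemma ev_decided_hstrips: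
  assumes "\<forall>\<^sub>F k in sequentially. partition_fun l (\<lambda>i. al i + int k * lam i)"
    and "\<And>i. r \<le> i \<Longrightarrow> g i = 0" "\<And>i. r \<le> i \<Longrightarrow> mu i = 0"
  shows "ev_decided (\<lambda>k. (\<lambda>i. g i + int k * mu i) \<in> hstrips l (\<lambda>i. al i + int k * lam i) (s + int k * t))"
proof (rule ev_decided_cong)
  let ?Q = "\<lambda>k. (\<forall>i\<in>{..<max l r}. al (Suc i) + int k * lam (Suc i) \<le> g i + int k * mu i \<and>
       g i + int k * mu i \<le> al i + int k * lam i) \<and>
     (\<Sum>i<l. g i) + int k * (\<Sum>i<l. mu i) = ((\<Sum>i<l. al i) - s) + int k * ((\<Sum>i<l. lam i) - t)"
  show "\<forall>\<^sub>F k in sequentially. (\<lambda>i. g i + int k * mu i) \<in> hstrips l (\<lambda>i. al i + int k * lam i) (s + int k * t) \<longleftrightarrow> ?Q k"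
    using assms(1)
  proof eventually_elim
    case (elim k)
    have "(\<forall>i. al (Suc i) + int k * lam (Suc i) \<le> g i + int k * mu i \<and> g i + int k * mu i \<le> al i + int k * lam i)
       \<longleftrightarrow> (\<forall>i\<in>{..<max l r}. al (Suc i) + int k * lam (Suc i) \<le> g i + int k * mu i \<and>
         g i + int k * mu i \<le> al i + int k * lam i)" (is "(\<forall>i. ?C i) \<longleftrightarrow> _")
    proof (intro iffI allI)
      fix i assume *: "\<forall>i\<in>{..<max l r}. ?C i"
      show "?C i"
      proof (cases "i < max l r")
        case False
        then show ?thesis using elim assms(2,3)[of i] by (auto simp: partition_fun_def)
      qed (use * in auto)
    qed auto
    moreover have "(\<Sum>i<l. g i + int k * mu i) = (\<Sum>i<l. al i + int k * lam i) - (s + int k * t) \<longleftrightarrow>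
       (\<Sum>i<l. g i) + int k * (\<Sum>i<l. mu i) = ((\<Sum>i<l. al i) - s) + int k * ((\<Sum>i<l. lam i) - t)"
      by (simp add: sum.distrib sum_distrib_left algebra_simps)
    ultimately show ?case unfolding hstrips_def by simp
  qed
  show "ev_decided ?Q"
    by (intro ev_decided_conj ev_decided_Ball ev_decided_linear_le ev_decided_linear_eq) auto
qed

text \<open>The horizontal strips that contribute are \<open>g + k lam'\<close> with \<open>lam'\<close> the truncation of \<open>lam\<close>
  and \<open>g\<close> bounded above by \<open>al\<close> and of prescribed sum: finitely many \<open>g\<close>, independently of \<open>k\<close>.\<close>
theorem kostka_stable:
  assumes "inj_on e {..<r}" "\<And>i. r \<le> i \<Longrightarrow> lam i = 0" "\<And>t. t < r \<Longrightarrow> A (e t) = lam t"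
    and "\<forall>\<^sub>F k in sequentially. partition_fun l (\<lambda>i. al i + int k * lam i)"
  shows "ev_const (\<lambda>k. kostka l (\<lambda>i. al i + int k * lam i) (e ` {..<r}) (\<lambda>c. D c + int k * A c))"
  using assms
proof (induction r arbitrary: al lam)
  case 0
  then have "\<exists>k :: nat. partition_fun l al" by (auto simp: eventually_sequentially)
  then show ?case using 0 by (simp add: kostka_empty)
next
  case (Suc r)
  have inj: "inj_on e {..<r}" using Suc.prems(1) by (rule inj_on_subset) auto
  define lam' where "lam' = (\<lambda>i. if i < r then lam i else 0)"
  define S where "S = (\<Sum>t<r. D (e t))"
  \<comment> \<open>The entries of \<open>g\<close> are at most those of \<open>al\<close> and add
    up to \<open>S\<close>. Hence each is at least \<open>S\<close> minus the sum of the other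
    \<open>al t\<close>, and \<open>M\<close> covers both bounds.\<close>
  define M where "M = (\<Sum>t<r. \<bar>al t\<bar>) + \<bar>S\<bar>"
  define Y where "Y = {g. \<forall>i. (i \<in> {..<r} \<longrightarrow> g i \<in> {-M..M}) \<and> (i \<notin> {..<r} \<longrightarrow> g i = (0::int))}"
  define f where "f k = (\<lambda>i. al i + int k * lam i)" for k
  define B where "B k = (\<lambda>c. D c + int k * A c)" for k
  define \<phi> where "\<phi> k g = (\<lambda>i. g i + int k * lam' i)" for k g
  have finY: "finite Y" unfolding Y_def by (rule finite_set_of_finite_funs) auto
  have step: "kostka l (f k) (e ` {..<Suc r}) (B k) =
      (\<Sum>g\<in>Y. if \<phi> k g \<in> hstrips l (f k) (B k (e r)) then kostka l (\<phi> k g) (e ` {..<r}) (B k) else 0)"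
    if pf: "partition_fun l (f k)" for k
  proof -
    let ?H = "hstrips l (f k) (B k (e r))" and ?K = "\<lambda>h. kostka l h (e ` {..<r}) (B k)"
    have "h \<in> \<phi> k ` Y" if h: "h \<in> ?H" and nz: "?K h \<noteq> 0" for h
    proof
      define g where "g = (\<lambda>i. h i - int k * lam' i)"
      show "h = \<phi> k g" by (simp add: g_def \<phi>_def)
      note Dh = kostka_nonzeroD[OF hstrips_partition[OF pf h] inj nz]
      have le: "g i \<le> al i" if "i < r" for i
        using h that by (auto simp: hstrips_def g_def f_def lam'_def algebra_simps)
      have "(\<Sum>i<r. g i) = (\<Sum>t<r. B k (e t)) - int k * (\<Sum>t<r. lam t)"
        using Dh by (simp add: g_def sum_subtractf sum_distrib_left lam'_def)
      also have "\<dots> = S"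
        using Suc.prems(3) by (simp add: B_def S_def sum.distrib sum_distrib_left)
      finally have gS: "(\<Sum>i<r. g i) = S" .
      have "- M \<le> g i \<and> g i \<le> M" if i: "i < r" for i
      proof
        have "\<bar>al i\<bar> \<le> (\<Sum>t<r. \<bar>al t\<bar>)" using i by (intro member_le_sum) auto
        then show "g i \<le> M" using le[OF i] by (simp add: M_def)
        have "S = g i + (\<Sum>t\<in>{..<r} - {i}. g t)" using i gS by (simp add: sum.remove)
        also have "(\<Sum>t\<in>{..<r} - {i}. g t) \<le> (\<Sum>t\<in>{..<r} - {i}. \<bar>al t\<bar>)"
          using le by (intro sum_mono) (auto intro: order_trans[OF le])
        also have "\<dots> \<le> (\<Sum>t<r. \<bar>al t\<bar>)" by (intro sum_mono2) auto
        finally show "- M \<le> g i" by (simp add: M_def)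
      qed
      moreover have "g i = 0" if "\<not> i < r" for i using Dh that by (simp add: g_def lam'_def)
      ultimately show "g \<in> Y" by (auto simp: Y_def)
    qed
    then have sub: "\<forall>h\<in>?H - \<phi> k ` Y \<inter> ?H. ?K h = 0" by blast
    have "kostka l (f k) (e ` {..<Suc r}) (B k) = sum ?K ?H"
      by (rule kostka_enum_Suc[OF pf Suc.prems(1)])
    also have "\<dots> = sum ?K (\<phi> k ` Y \<inter> ?H)"
      using sub by (intro sum.mono_neutral_right finite_hstrips[OF pf]) auto
    also have "\<dots> = (\<Sum>h\<in>\<phi> k ` Y. if h \<in> ?H then ?K h else 0)"
      using finY by (intro sum.inter_restrict) auto
    also have "\<dots> = (\<Sum>g\<in>Y. if \<phi> k g \<in> ?H then ?K (\<phi> k g) else 0)"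
    proof (rule sum.reindex_cong[OF _ refl refl])
      show "inj_on (\<phi> k) Y" by (auto simp: inj_on_def \<phi>_def fun_eq_iff)
    qed
    finally show ?thesis .
  qed
  have ev: "\<forall>\<^sub>F k in sequentially. partition_fun l (f k)" using Suc.prems(4) by (simp add: f_def)
  have "ev_const (\<lambda>k. if \<phi> k g \<in> hstrips l (f k) (B k (e r)) then kostka l (\<phi> k g) (e ` {..<r}) (B k) else 0)"
    if g: "g \<in> Y" for g
  proof (rule ev_const_if)
    show "ev_decided (\<lambda>k. \<phi> k g \<in> hstrips l (f k) (B k (e r)))"
      unfolding \<phi>_def f_def B_def
    proof (rule ev_decided_hstrips[OF Suc.prems(4), of r])
      show "g i = 0" "lam' i = 0" if "r \<le> i" for i using g that by (auto simp: Y_def lam'_def)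
    qed
    \<comment> \<open>\<open>g\<close> may have negative entries and need not be a partition; g + k
      lam' is one for large k, by interlacing with \<open>f k\<close>. This is why the induction
      carries the partition hypothesis in its eventual form.\<close>
    assume H: "\<forall>\<^sub>F k in sequentially. \<phi> k g \<in> hstrips l (f k) (B k (e r))"
    show "ev_const (\<lambda>k. kostka l (\<phi> k g) (e ` {..<r}) (B k))"
      unfolding \<phi>_def B_def
    proof (rule Suc.IH[OF inj])
      show "\<forall>\<^sub>F k in sequentially. partition_fun l (\<lambda>i. g i + int k * lam' i)"
        using ev H by eventually_elim (auto intro: hstrips_partition simp: \<phi>_def)
    qed (use Suc.prems(3) in \<open>auto simp: lam'_def\<close>)
  qed
  then have "ev_const (\<lambda>k. \<Sum>g\<in>Y. if \<phi> k g \<in> hstrips l (f k) (B k (e r)) then kostka l (\<phi> k g) (e ` {..<r}) (B k) else 0)"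
    by (rule ev_const_sum)
  moreover have "\<forall>\<^sub>F k in sequentially. kostka l (f k) (e ` {..<Suc r}) (B k) =
     (\<Sum>g\<in>Y. if \<phi> k g \<in> hstrips l (f k) (B k (e r)) then kostka l (\<phi> k g) (e ` {..<r}) (B k) else 0)"
    using ev by eventually_elim (rule step)
  ultimately show ?case using ev_const_cong[of "\<lambda>k. kostka l (f k) (e ` {..<Suc r}) (B k)"] by (simp add: f_def B_def)
qed

section \<open>The arrangement of a partition in an m by n matrix\<close>

text \<open>The equations \<open>(\<ast>)\<close> say that \<open>\<mu>\<close> and \<open>\<nu>\<close> are the row and column sums of the matrix with
  entry \<open>\<lambda>\<close> at position \<open>idx m n i j\<close> (all indices from 0): the first column is filled first,
  then the remaining rows one after the other.\<close>
definition idx :: "nat \<Rightarrow> nat \<Rightarrow> nat \<Rightarrow> nat \<Rightarrow> nat" where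
  "idx m n i j = (if j = 0 then i else m + i * (n - 1) + (j - 1))"

text \<open>The inverse of \<open>idx\<close> on numbers below m * n. For n = 1 these are all below
  \<open>m\<close>, so the division by n - 1 = 0 is not reached.\<close>

definition cell :: "nat \<Rightarrow> nat \<Rightarrow> nat \<Rightarrow> nat \<times> nat" where
  "cell m n t = (if t < m then (t, 0) else ((t - m) div (n - 1), (t - m) mod (n - 1) + 1))"

lemma idx_less: "i < m \<Longrightarrow> j < n \<Longrightarrow> idx m n i j < m * n"
proof -
  assume i: "i < m" and j: "j < n"
  show ?thesis
  proof (cases "j = 0")
    case True
    then show ?thesis using i j by (simp add: idx_def) (metis One_nat_def Suc_leI less_le_trans mult_le_mono2 nat_mult_1_right)
  next
    case False
    have "i * (n - 1) + (n - 1) \<le> m * (n - 1)"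
      using i by (metis Suc_leI add.commute mult_Suc mult_le_mono1)
    moreover have "m + m * (n - 1) = m * n" using j by (cases n) auto
    ultimately show ?thesis using False j unfolding idx_def by simp
  qed
qed

lemma cell_idx: "i < m \<Longrightarrow> j < n \<Longrightarrow> cell m n (idx m n i j) = (i, j)"
proof -
  assume i: "i < m" and j: "j < n"
  show ?thesis
  proof (cases "j = 0")
    case False
    then have "j - 1 < n - 1" using j by simp
    then have "(i * (n - 1) + (j - 1)) div (n - 1) = i" "(i * (n - 1) + (j - 1)) mod (n - 1) = j - 1"
      by simp_all
    then show ?thesis using False by (simp add: cell_def idx_def)
  qed (use i in \<open>simp add: cell_def idx_def\<close>)
qed

lemma bij_betw_idx:
  "bij_betw (\<lambda>(i, j). idx m n i j) ({..<m} \<times> {..<n}) {..<m * n}"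
proof -
  have inj: "inj_on (\<lambda>(i, j). idx m n i j) ({..<m} \<times> {..<n})"
    by (rule inj_on_inverseI[of _ "cell m n"]) (auto simp: cell_idx)
  moreover have "(\<lambda>(i, j). idx m n i j) ` ({..<m} \<times> {..<n}) = {..<m * n}"
    by (rule card_subset_eq) (auto simp: idx_less card_image[OF inj])
  ultimately show ?thesis by (simp add: bij_betw_def)
qed

lemma cell_mem: "t < m * n \<Longrightarrow> cell m n t \<in> {..<m} \<times> {..<n}"
  and idx_cell: "t < m * n \<Longrightarrow> idx m n (fst (cell m n t)) (snd (cell m n t)) = t"
proof -
  assume "t < m * n"
  then have "t \<in> (\<lambda>(i, j). idx m n i j) ` ({..<m} \<times> {..<n})"
    using bij_betw_idx[of m n] by (simp add: bij_betw_def)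
  then obtain i j where "i < m" "j < n" "t = idx m n i j" by auto
  then show "cell m n t \<in> {..<m} \<times> {..<n}" "idx m n (fst (cell m n t)) (snd (cell m n t)) = t"
    by (simp_all add: cell_idx)
qed

lemma bij_betw_cell: "bij_betw (cell m n) {..<m * n} ({..<m} \<times> {..<n})"
proof (rule bij_betw_byWitness[where f' = "\<lambda>(i, j). idx m n i j"])
  show "cell m n ` {..<m * n} \<subseteq> {..<m} \<times> {..<n}" using cell_mem by blast
qed (auto simp: case_prod_beta cell_idx idx_cell idx_less)

text \<open>With i = u - 1, the term \<lambda>_u is the entry of row i in column 0, and the
  summation range consists of the successors of \<open>idx m n i j\<close> for 0 < j < n. Column 0
  gives the equation for \<nu>_1 and column v - 1 the one for \<nu>_v.\<close>

lemma star_eqs_iff: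
  assumes "m > 0" "n > 0"
  shows "star_eqs m n (\<lambda>i. x (i - 1)) (\<lambda>i. y (i - 1)) (\<lambda>i. z (i - 1)) \<longleftrightarrow>
    (\<forall>i<m. y i = (\<Sum>j<n. x (idx m n i j))) \<and> (\<forall>j<n. z j = (\<Sum>i<m. x (idx m n i j)))"
proof -
  have row: "x (Suc i - 1) + (\<Sum>k\<in>{m + (Suc i - 1) * (n - 1) + 1..m + Suc i * (n - 1)}. x (k - 1))
      = (\<Sum>j<n. x (idx m n i j))" for i
  proof -
    have "(\<Sum>j<n. x (idx m n i j)) = x i + (\<Sum>j\<in>{..<n} - {0}. x (idx m n i j))"
      using assms by (subst sum.remove[of _ 0]) (auto simp: idx_def)
    also have "(\<Sum>j\<in>{..<n} - {0}. x (idx m n i j)) =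
        (\<Sum>k\<in>{m + (Suc i - 1) * (n - 1) + 1..m + Suc i * (n - 1)}. x (k - 1))"
      by (rule sum.reindex_bij_witness[of _ "\<lambda>k. k - (m + i * (n - 1))" "\<lambda>j. j + (m + i * (n - 1))"])
        (auto simp: idx_def add.commute intro!: arg_cong[of _ _ x])
    finally show ?thesis by simp
  qed
  have "{1..m} = Suc ` {..<m}"
    by (simp add: image_Suc_lessThan)
  then have "(\<forall>u\<in>{1..m}. P u) \<longleftrightarrow> (\<forall>i<m. P (Suc i))" for P
    by auto
  then have rows: "(\<forall>u\<in>{1..m}. y (u - 1) = x (u - 1) + (\<Sum>i\<in>{m + (u-1)*(n-1) + 1 .. m + u*(n-1)}. x (i - 1)))
     \<longleftrightarrow> (\<forall>i<m. y i = (\<Sum>j<n. x (idx m n i j)))"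
    using row by simp
  have col0: "(\<Sum>i\<in>{1..m}. x (i - 1)) = (\<Sum>i<m. x (idx m n i 0))"
    by (rule sum.reindex_bij_witness[of _ "\<lambda>k. k + 1" "\<lambda>j. j - 1"]) (auto simp: idx_def)
  have col: "(\<Sum>i\<in>{0..m-1}. x (m + (n-1)*i + v - 1 - 1)) = (\<Sum>i<m. x (idx m n i (v - 1)))" if "v \<ge> 2" for v
    using that assms by (intro sum.cong) (auto simp: idx_def mult.commute intro!: arg_cong[of _ _ x])
  have cols: "(\<forall>v\<in>{2..n}. z (v - 1) = (\<Sum>i\<in>{0..m-1}. x (m + (n-1)*i + v - 1 - 1))) \<and> z 0 = (\<Sum>i\<in>{1..m}. x (i - 1))
     \<longleftrightarrow> (\<forall>j<n. z j = (\<Sum>i<m. x (idx m n i j)))" (is "?L \<longleftrightarrow> ?R")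
  proof
    assume L: ?L
    show ?R
    proof (intro allI impI)
      fix j assume "j < n"
      then show "z j = (\<Sum>i<m. x (idx m n i j))"
        using L col0 col[of "Suc j"] by (cases "j = 0") (auto dest: bspec[of _ _ "Suc j"])
    qed
  next
    assume R: ?R
    show ?L using R col0 col assms by auto
  qed
  show ?thesis unfolding star_eqs_def using rows cols by auto
qed

section \<open>An additive weight realising this arrangement\<close>

text \<open>Steps of n between rows exceed the spread of the column weights -1, ..., -(n - 1), so
  beyond column 0 the rows are read one after the other; the weight m n of column 0 puts that column
  first. The value -m n outside the corner cancels the largest weight of the other
  coordinate.\<close>

definition wx :: "nat \<Rightarrow> nat \<Rightarrow> nat \<Rightarrow> int" where
  "wx m n i = (if i < m then int n * (int m - int i) else - (int m * int n))"

definition wy :: "nat \<Rightarrow> nat \<Rightarrow> nat \<Rightarrow> int" where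
  "wy m n j = (if j = 0 then int m * int n else if j < n then - int j else - (int m * int n))"

definition wt :: "nat \<Rightarrow> nat \<Rightarrow> nat \<times> nat \<Rightarrow> int" where
  "wt m n c = wx m n (fst c) + wy m n (snd c)"

lemma wt_outside:
  assumes "n > 0" "c \<notin> {..<m} \<times> {..<n}"
  shows "wt m n c \<le> 0"
proof (cases c)
  case (Pair i j)
  have "int n * (int m - int i) \<le> int m * int n" by (simp add: algebra_simps)
  moreover have "- (int m * int n) \<le> int j" by (rule order_trans[of _ 0]) auto
  ultimately show ?thesis using assms Pair by (auto simp: wt_def wx_def wy_def)
qed

text \<open>For t \<ge> m the cell is (d, e + 1) with t - m = d (n - 1) + e, and n d + e = (t - m) +
  d: one unit per step and one more per completed row. This form shows the strict decrease and the
  positivity.\<close>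

lemma wt_cell:
  assumes "t < m * n"
  shows "wt m n (cell m n t) = (if t < m then int m * int n + int n * (int m - int t)
     else int m * int n - 1 - int (t - m) - int ((t - m) div (n - 1)))"
proof (cases "t < m")
  case True
  then show ?thesis by (simp add: wt_def cell_def wx_def wy_def)
next
  case False
  then have mem: "(t - m) div (n - 1) < m" "(t - m) mod (n - 1) + 1 < n"
    using cell_mem[OF assms] by (auto simp: cell_def)
  define d where "d = (t - m) div (n - 1)"
  define e where "e = (t - m) mod (n - 1)"
  have "t - m = d * (n - 1) + e" unfolding d_def e_def by (rule div_mult_mod_eq[symmetric])
  then have "int (t - m) = int d * (int n - 1) + int e" using mem by (simp add: of_nat_diff)
  moreover have "cell m n t = (d, e + 1)" using False by (simp add: cell_def d_def e_def)
  moreover have "d < m" "e + 1 < n" using mem by (simp_all add: d_def e_def)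
  ultimately show ?thesis using False
    unfolding d_def[symmetric] by (simp add: wt_def wx_def wy_def algebra_simps)
qed

lemma wt_cell_decreasing:
  assumes "Suc t < m * n"
  shows "wt m n (cell m n (Suc t)) + 1 \<le> wt m n (cell m n t)"
proof -
  have n: "n \<ge> 1" using assms by (cases n) auto
  consider "Suc t < m" | "Suc t = m" | "m \<le> t" by linarith
  then show ?thesis
  proof cases
    case 1
    then show ?thesis using assms n by (simp add: wt_cell algebra_simps)
  next
    case 2
    have "0 \<le> int n * (int m - int t)" using 2 by simp
    moreover have "t < m * n" using assms by simp
    ultimately have "int m * int n \<le> wt m n (cell m n t)" using 2 by (subst wt_cell) auto
    moreover have "wt m n (cell m n (Suc t)) \<le> int m * int n - 1"
      using 2 assms by (subst wt_cell) auto
    ultimately show ?thesis by simp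
  next
    case 3
    define a where "a = (t - m) div (n - 1)"
    define b where "b = (Suc t - m) div (n - 1)"
    have "a \<le> b" unfolding a_def b_def by (intro div_le_mono) simp
    moreover have "wt m n (cell m n t) = int m * int n - 1 - int (t - m) - int a"
      using 3 assms wt_cell[of t m n] by (simp add: a_def)
    moreover have "wt m n (cell m n (Suc t)) = int m * int n - 1 - int (Suc t - m) - int b"
      using 3 wt_cell[OF assms] by (simp add: b_def)
    ultimately show ?thesis using 3 by simp
  qed
qed

lemma wt_cell_pos:
  assumes "t < m * n"
  shows "1 \<le> wt m n (cell m n t)"
proof -
  have n: "n \<ge> 1" using assms by (cases n) auto
  show ?thesis
  proof (cases "t < m")
    case True
    have "1 * 1 \<le> int n * (int m - int t)" using True n by (intro mult_mono) auto
    then show ?thesis using True assms by (simp add: wt_cell add_increasing)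
  next
    case False
    have m: "(t - m) div (n - 1) < m" using False cell_mem[OF assms] by (auto simp: cell_def)
    have "int t < int m * int n" using assms by (metis of_nat_less_iff of_nat_mult)
    then show ?thesis using False assms m by (simp add: wt_cell)
  qed
qed

text \<open>The rearrangement inequality as an identity: \<open>w\<close> preserves the sum of
  squares, so expanding the right side gives twice the left. The left sum is thus nonnegative and
  vanishes for the identity only.\<close>

lemma sum_weight_permutes:
  assumes w: "w permutes {..<p}"
  shows "2 * (\<Sum>i<p. int i * (int i - int (w i))) = (\<Sum>i<p. (int i - int (w i))\<^sup>2)"
proof -
  have "(\<Sum>i<p. (int (w i))\<^sup>2) = (\<Sum>i<p. (int i)\<^sup>2)"
    using sum.permute[OF w, of "\<lambda>i. (int i)\<^sup>2"] by (simp add: o_def)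
  then show ?thesis
    by (simp add: power2_eq_square sum_distrib_left sum_subtractf sum.distrib algebra_simps)
qed

lemma permutes_eq_id_if_sum_sq:
  assumes w: "w permutes {..<p}" and le: "(\<Sum>i<p. int i * (int i - int (w i))) \<le> 0"
  shows "w = id"
proof (rule permutes_natset_le)
  have "(\<Sum>i<p. (int i - int (w i))\<^sup>2) = 0"
    using le sum_weight_permutes[OF w] by (intro antisym sum_nonneg) auto
  then show "\<forall>i\<in>{..<p}. w i \<le> i" by (simp add: sum_nonneg_eq_0_iff)
qed (rule w)

text \<open>Over the corner rows the weight is affine with slope -n. Its constant part contributes
  nothing, since \<open>w\<close> preserves the sum of the indices; the slope leaves the
  rearrangement term.\<close>

lemma sum_wx_shift:
  assumes w: "w permutes {..<m}"
  shows "(\<Sum>i<m. wx m n i * shift f w i) =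
    (\<Sum>i<m. wx m n i * f i) + int n * (\<Sum>i<m. int i * (int i - int (w i)))"
proof -
  have "(\<Sum>i<m. int (w i)) = (\<Sum>i<m. int i)"
    using sum.permute[OF w, of int] by (simp add: o_def)
  then have "(\<Sum>i<m. int m * int n * (int (w i) - int i)) = 0"
    by (simp add: sum_subtractf flip: sum_distrib_left)
  moreover have "(\<Sum>i<m. wx m n i * shift f w i) = (\<Sum>i<m. wx m n i * f i + int m * int n * (int (w i) - int i)
     + int n * (int i * (int i - int (w i))))"
    by (intro sum.cong) (auto simp: wx_def shift_def algebra_simps)
  ultimately show ?thesis by (simp add: sum.distrib sum_distrib_left)
qed

text \<open>As for the rows, with slope -1; the extra weight m n of column 0 adds a multiple of
  \<open>v 0\<close>, which is nonnegative as well.\<close>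

lemma sum_wy_shift:
  assumes v: "v permutes {..<n}" and n: "n > 0"
  shows "(\<Sum>j<n. wy m n j * shift f v j) =
    (\<Sum>j<n. wy m n j * f j) + int m * int n * int (v 0) + (\<Sum>j<n. int j * (int j - int (v j)))"
proof -
  have "(\<Sum>j<n. wy m n j * shift f v j) = (\<Sum>j<n. wy m n j * f j
     + (if j = 0 then int m * int n * int (v 0) else 0) + int j * (int j - int (v j)))"
    by (intro sum.cong) (auto simp: wy_def shift_def algebra_simps)
  then show ?thesis using n by (simp add: sum.distrib)
qed

section \<open>Pairing Kostka numbers with the weights\<close>

text \<open>For tables larger than m by n, dominance is read along an enumeration that begins with
  the corner in order of weight and continues arbitrarily.\<close>

lemma enum_exists:
  assumes "m \<le> p" "n \<le> q"
  obtains e where "bij_betw e {..<p * q} ({..<p} \<times> {..<q})" "\<And>t. t < m * n \<Longrightarrow> e t = cell m n t"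
proof -
  have sub: "{..<m} \<times> {..<n} \<subseteq> {..<p} \<times> {..<q}" using assms by auto
  have le: "m * n \<le> p * q" using assms by (rule mult_le_mono)
  have "card {m * n..<p * q} = card ({..<p} \<times> {..<q} - {..<m} \<times> {..<n})"
    using sub by (subst card_Diff_subset) auto
  then obtain h where h: "bij_betw h {m * n..<p * q} ({..<p} \<times> {..<q} - {..<m} \<times> {..<n})"
    using finite_same_card_bij[of "{m * n..<p * q}" "{..<p} \<times> {..<q} - {..<m} \<times> {..<n}"] by auto
  define e where "e t = (if t \<in> {..<m * n} then cell m n t else h t)" for t
  have "bij_betw e ({..<m * n} \<union> {m * n..<p * q})
      (({..<m} \<times> {..<n}) \<union> ({..<p} \<times> {..<q} - {..<m} \<times> {..<n}))"
    unfolding e_def using h bij_betw_cell by (intro bij_betw_disjoint_Un) auto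
  moreover have "{..<m * n} \<union> {m * n..<p * q} = {..<p * q}" using le by auto
  moreover have "({..<m} \<times> {..<n}) \<union> ({..<p} \<times> {..<q} - {..<m} \<times> {..<n}) = {..<p} \<times> {..<q}"
    using sub by auto
  ultimately have "bij_betw e {..<p * q} ({..<p} \<times> {..<q})" by simp
  then show ?thesis by (rule that) (simp add: e_def)
qed

lemma sum_by_parts:
  fixes D \<psi> :: "nat \<Rightarrow> 'a::comm_ring_1"
  shows "(\<Sum>t<M. D t * \<psi> t) =
    (\<Sum>t<M. (\<Sum>s<Suc t. D s) * (\<psi> t - \<psi> (Suc t))) + (\<Sum>s<M. D s) * \<psi> M"
  by (induction M) (simp_all add: algebra_simps)

text \<open>Here additivity of the weight enters: the pairing sees only the margins of
  \<open>B\<close>.\<close>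

lemma sum_mult_wt:
  fixes B :: "nat \<times> nat \<Rightarrow> 'a::comm_ring_1"
  shows "(\<Sum>c\<in>{..<p} \<times> {..<q}. B c * of_int (wt m n c)) =
    (\<Sum>i<p. of_int (wx m n i) * (\<Sum>j<q. B (i, j))) + (\<Sum>j<q. of_int (wy m n j) * (\<Sum>i<p. B (i, j)))"
proof -
  have "(\<Sum>c\<in>{..<p} \<times> {..<q}. B c * of_int (wt m n c)) =
     (\<Sum>i<p. \<Sum>j<q. of_int (wx m n i) * B (i, j) + of_int (wy m n j) * B (i, j))"
    by (simp add: sum.cartesian_product wt_def algebra_simps case_prod_beta)
  also have "\<dots> = (\<Sum>i<p. \<Sum>j<q. of_int (wx m n i) * B (i, j)) + (\<Sum>i<p. \<Sum>j<q. of_int (wy m n j) * B (i, j))"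
    by (simp add: sum.distrib)
  also have "(\<Sum>i<p. \<Sum>j<q. of_int (wy m n j) * B (i, j)) = (\<Sum>j<q. \<Sum>i<p. of_int (wy m n j) * B (i, j))"
    by (rule sum.swap)
  finally show ?thesis by (simp add: sum_distrib_left)
qed

lemma bij_betw_enum_outside:
  assumes e: "bij_betw e {..<p * q} ({..<p} \<times> {..<q})" "\<And>t. t < m * n \<Longrightarrow> e t = cell m n t"
    and le: "m * n \<le> p * q" and t: "m * n \<le> t" "t < p * q"
  shows "e t \<notin> {..<m} \<times> {..<n}"
proof
  assume "e t \<in> {..<m} \<times> {..<n}"
  then obtain i j where ij: "e t = (i, j)" "i < m" "j < n" by auto
  then have "e (idx m n i j) = e t" using e(2) by (simp add: idx_less cell_idx)
  moreover have "idx m n i j < m * n" using ij by (simp add: idx_less)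
  ultimately have "idx m n i j = t"
    using e(1) t le by (auto simp: bij_betw_def inj_on_def)
  then show False using \<open>idx m n i j < m * n\<close> t by simp
qed

text \<open>Only cells of the \<open>m\<close> by \<open>n\<close> corner have positive weight, so Abel summation against the
  weights bounds all partial sums of \<open>f - B\<close> over that corner at once.\<close>
lemma partial_sums_le_weight:
  assumes n: "n > 0" and le: "m * n \<le> p * q" and f: "partition_fun l f"
    and e: "bij_betw e {..<p * q} ({..<p} \<times> {..<q})" "\<And>t. t < m * n \<Longrightarrow> e t = cell m n t"
    and B: "B \<in> tables {..<p} {..<q} a b"
    and nz: "kostka l f ({..<p} \<times> {..<q}) B \<noteq> 0"
  shows "(\<Sum>t<m * n. \<Sum>s<Suc t. f s - B (e s)) \<le> (\<Sum>t<m * n. f t * wt m n (cell m n t))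
    - (\<Sum>i<p. wx m n i * a i) - (\<Sum>j<q. wy m n j * b j)"
proof -
  define D where "D t = f t - B (e t)" for t
  \<comment> \<open>Cutting off at m * n removes the boundary term of the Abel summation; the last
    difference is still at least 1 because corner weights are positive.\<close>
  define \<psi> where "\<psi> t = (if t < m * n then wt m n (cell m n t) else 0)" for t
  have inj: "inj_on e {..<p * q}" and im: "e ` {..<p * q} = {..<p} \<times> {..<q}"
    using e(1) by (auto simp: bij_betw_def)
  have pos: "0 \<le> (\<Sum>s<t. D s)" if "t \<le> p * q" for t
    using kostka_nonzeroD[OF f inj] nz that by (simp add: im D_def sum_subtractf)
  have "(\<Sum>t<m * n. \<Sum>s<Suc t. D s) \<le> (\<Sum>t<m * n. (\<Sum>s<Suc t. D s) * (\<psi> t - \<psi> (Suc t)))"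
  proof (rule sum_mono)
    fix t assume t: "t \<in> {..<m * n}"
    have "1 \<le> \<psi> t - \<psi> (Suc t)"
      using t wt_cell_decreasing[of t m n] wt_cell_pos[of t m n] by (auto simp: \<psi>_def)
    moreover have "0 \<le> (\<Sum>s<Suc t. D s)" using t le by (intro pos) simp
    ultimately have "(\<Sum>s<Suc t. D s) * 1 \<le> (\<Sum>s<Suc t. D s) * (\<psi> t - \<psi> (Suc t))"
      by (intro mult_left_mono)
    then show "(\<Sum>s<Suc t. D s) \<le> (\<Sum>s<Suc t. D s) * (\<psi> t - \<psi> (Suc t))" by simp
  qed
  also have "\<dots> = (\<Sum>t<m * n. D t * \<psi> t)"
    by (subst sum_by_parts) (simp add: \<psi>_def)
  also have "\<dots> = (\<Sum>t<m * n. f t * wt m n (cell m n t)) - (\<Sum>t<m * n. B (e t) * wt m n (e t))"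
    by (simp add: D_def \<psi>_def e(2) algebra_simps sum_subtractf)
  finally have upper: "(\<Sum>t<m * n. \<Sum>s<Suc t. D s) \<le>
    (\<Sum>t<m * n. f t * wt m n (cell m n t)) - (\<Sum>t<m * n. B (e t) * wt m n (e t))" .
  \<comment> \<open>Outside the corner the weight is at most 0 and \<open>B\<close> is nonnegative,
    so extending the sum to all cells can only lower it, and the full pairing is known from the
    margins.\<close>
  have "(\<Sum>t<m * n. B (e t) * wt m n (e t)) \<ge> (\<Sum>t<p * q. B (e t) * wt m n (e t))"
  proof -
    have "B (e t) * wt m n (e t) \<le> 0" if t: "m * n \<le> t" "t < p * q" for t
    proof -
      have "wt m n (e t) \<le> 0" using n bij_betw_enum_outside[OF e le t] by (rule wt_outside)
      moreover have "e t \<in> {..<p} \<times> {..<q}" using im t by blast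
      then have "0 \<le> B (e t)" using B by (auto simp: tables_def PiE_def Pi_def)
      ultimately show ?thesis by (rule mult_nonneg_nonpos[rotated])
    qed
    then have "(\<Sum>t\<in>{m * n..<p * q}. B (e t) * wt m n (e t)) \<le> 0"
      by (intro sum_nonpos) auto
    moreover have "{..<p * q} = {..<m * n} \<union> {m * n..<p * q}" using le by auto
    ultimately show ?thesis by (simp add: sum.union_disjoint ivl_disj_int)
  qed
  moreover have "(\<Sum>t<p * q. B (e t) * wt m n (e t)) = (\<Sum>c\<in>{..<p} \<times> {..<q}. B c * wt m n c)"
    by (rule sum.reindex_bij_betw[OF e(1)])
  also have "\<dots> = (\<Sum>i<p. wx m n i * a i) + (\<Sum>j<q. wy m n j * b j)"
    using sum_mult_wt[of B m n p q] B by (simp add: tables_def)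
  ultimately show ?thesis using upper by (simp add: D_def)
qed

text \<open>The linear form cutting out the face: nonnegative on the Kronecker cone,
  zero exactly where the equations \<open>(\<ast>)\<close> hold.\<close>
definition excess :: "nat \<Rightarrow> nat \<Rightarrow> (nat \<Rightarrow> 'a) \<Rightarrow> (nat \<Rightarrow> 'a) \<Rightarrow> (nat \<Rightarrow> 'a) \<Rightarrow> 'a::comm_ring_1" where
  "excess m n f g h = (\<Sum>t<m * n. f t * of_int (wt m n (cell m n t)))
    - (\<Sum>i<m. of_int (wx m n i) * g i) - (\<Sum>j<n. of_int (wy m n j) * h j)"

definition matrix_sums :: "nat \<Rightarrow> nat \<Rightarrow> (nat \<Rightarrow> 'a::comm_monoid_add) \<Rightarrow> (nat \<Rightarrow> 'a) \<Rightarrow> (nat \<Rightarrow> 'a) \<Rightarrow> bool" where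
  "matrix_sums m n f g h \<longleftrightarrow>
    (\<forall>i<m. g i = (\<Sum>j<n. f (idx m n i j))) \<and> (\<forall>j<n. h j = (\<Sum>i<m. f (idx m n i j)))"

lemma sum_idx: "(\<Sum>t<m * n. F t (cell m n t)) = (\<Sum>(i, j)\<in>{..<m} \<times> {..<n}. F (idx m n i j) (i, j))"
proof -
  have "(\<Sum>(i, j)\<in>{..<m} \<times> {..<n}. F (idx m n i j) (i, j))
     = (\<Sum>t<m * n. case cell m n t of (i, j) \<Rightarrow> F (idx m n i j) (i, j))"
    by (rule sum.reindex_bij_betw[OF bij_betw_cell, symmetric])
  also have "\<dots> = (\<Sum>t<m * n. F t (cell m n t))"
    using idx_cell by (intro sum.cong) (auto simp: case_prod_beta)
  finally show ?thesis by simp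
qed

text \<open>The first sum pairs the weights with a matrix whose margins are \<open>g\<close> and
  \<open>h\<close>, so additivity equates it with the other two.\<close>

lemma excess_eq_0:
  assumes "matrix_sums m n f g h"
  shows "excess m n f g h = 0"
proof -
  have "(\<Sum>t<m * n. f t * of_int (wt m n (cell m n t))) =
     (\<Sum>c\<in>{..<m} \<times> {..<n}. f (idx m n (fst c) (snd c)) * of_int (wt m n c))"
    by (subst sum_idx) (simp add: case_prod_beta)
  then show ?thesis
    using assms by (simp add: excess_def sum_mult_wt matrix_sums_def)
qed

lemma matrix_sums_total:
  assumes "matrix_sums m n f g h"
  shows "(\<Sum>i<m. g i) = (\<Sum>t<m * n. f t)" "(\<Sum>j<n. h j) = (\<Sum>t<m * n. f t)"
proof -
  have f: "(\<Sum>t<m * n. f t) = (\<Sum>i<m. \<Sum>j<n. f (idx m n i j))"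
    using sum_idx[of "\<lambda>t _. f t" m n] by (simp add: sum.cartesian_product)
  then show "(\<Sum>i<m. g i) = (\<Sum>t<m * n. f t)" using assms by (simp add: matrix_sums_def)
  show "(\<Sum>j<n. h j) = (\<Sum>t<m * n. f t)"
    unfolding f using assms by (simp add: matrix_sums_def sum.swap[of _ "{..<n}"])
qed

text \<open>The excess is at least a sum of nonnegative quantities: the rearrangement terms of
  \<open>w\<close> and \<open>v\<close>, a multiple of \<open>v 0\<close>, and the partial sums of f
  - B. If it is not positive they all vanish, which fixes \<open>w\<close>, \<open>v\<close> and the
  entries of \<open>B\<close>.\<close>

lemma kostka_term_nonzeroD:
  assumes mn: "m > 0" "n > 0" and f: "partition_fun l f"
    and w: "w permutes {..<m}" and v: "v permutes {..<n}"
    and B: "B \<in> tables {..<m} {..<n} (shift g w) (shift h v)"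
    and nz: "kostka l f ({..<m} \<times> {..<n}) B \<noteq> 0"
  shows "0 \<le> excess m n f g h"
    and "excess m n f g h \<le> 0 \<Longrightarrow> w = id \<and> v = id \<and> (\<forall>t<m * n. B (cell m n t) = f t)"
proof -
  let ?e = "cell m n"
  define W where "W = (\<Sum>i<m. int i * (int i - int (w i)))"
  define V where "V = (\<Sum>j<n. int j * (int j - int (v j)))"
  define S where "S t = (\<Sum>s<t. f s - B (?e s))" for t
  have inj: "inj_on ?e {..<m * n}" and im: "?e ` {..<m * n} = {..<m} \<times> {..<n}"
    using bij_betw_cell by (auto simp: bij_betw_def)
  have S: "0 \<le> S t" if "t \<le> m * n" for t
    using kostka_nonzeroD[OF f inj] nz that by (simp add: im S_def sum_subtractf)
  have "0 \<le> 2 * W" unfolding W_def sum_weight_permutes[OF w] by (intro sum_nonneg) auto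
  then have W0: "0 \<le> W" by simp
  have "0 \<le> 2 * V" unfolding V_def sum_weight_permutes[OF v] by (intro sum_nonneg) auto
  then have V0: "0 \<le> V" by simp
  have nW: "W \<le> int n * W" using W0 mn by (simp add: mult_le_cancel_right1)
  have v00: "0 \<le> int m * int n * int (v 0)" by simp
  have sum0: "0 \<le> (\<Sum>t<m * n. S (Suc t))" by (intro sum_nonneg S) auto
  have "(\<Sum>t<m * n. S (Suc t)) \<le> (\<Sum>t<m * n. f t * wt m n (?e t))
    - (\<Sum>i<m. wx m n i * shift g w i) - (\<Sum>j<n. wy m n j * shift h v j)"
    unfolding S_def using partial_sums_le_weight[OF mn(2) le_refl f bij_betw_cell refl B nz] .
  also have "\<dots> = excess m n f g h - int n * W - int m * int n * int (v 0) - V"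
    by (simp add: excess_def sum_wx_shift[OF w] sum_wy_shift[OF v mn(2)] W_def V_def)
  finally have *: "(\<Sum>t<m * n. S (Suc t)) \<le> excess m n f g h - int n * W - int m * int n * int (v 0) - V" .
  show "0 \<le> excess m n f g h" using * sum0 W0 nW V0 v00 by linarith
  assume le: "excess m n f g h \<le> 0"
  have "W \<le> 0" "V \<le> 0" "(\<Sum>t<m * n. S (Suc t)) = 0"
    using * sum0 W0 nW V0 v00 le by linarith+
  have "S (Suc t) = 0" if "t < m * n" for t
    using \<open>(\<Sum>t<m * n. S (Suc t)) = 0\<close> that S by (subst (asm) sum_nonneg_eq_0_iff) auto
  then have "S t = 0" if "t \<le> m * n" for t
    using that by (cases t) (auto simp: S_def)
  then have "f t - B (?e t) = 0" if "t < m * n" for t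
    using that S_def[of "Suc t"] S_def[of t] by simp
  moreover have "w = id"
    using w \<open>W \<le> 0\<close> unfolding W_def by (rule permutes_eq_id_if_sum_sq)
  moreover have "v = id"
    using v \<open>V \<le> 0\<close> unfolding V_def by (rule permutes_eq_id_if_sum_sq)
  ultimately show "w = id \<and> v = id \<and> (\<forall>t<m * n. B (?e t) = f t)" by simp
qed

section \<open>The supporting inequality and the value on the face\<close>

lemma shift_id [simp]: "shift f id = f"
  by (simp add: shift_def fun_eq_iff)

lemma partition_parts:
  assumes "is_part xs" "length xs \<le> l"
  shows "partition_fun l (parts xs)"
  unfolding partition_fun_def
proof (intro conjI allI impI)
  show "parts xs (Suc i) \<le> parts xs i" for i
    using assms sorted_wrt_nth_less[of "(\<ge>)" xs i "Suc i"] by (auto simp: is_part_def parts_def getd_def)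
qed (use assms in \<open>auto simp: parts_def getd_def\<close>)

text \<open>A nonzero alternating sum has a nonzero term. If the excess is not positive, that term
  has w = v = id, so its table, filled by \<open>lam\<close>, has \<open>mu\<close> and
  \<open>nu\<close> themselves as margins.\<close>

lemma kron_nonzeroD:
  assumes mn: "m > 0" "n > 0" and len: "length mu = m" "length nu = n" and lam: "is_part lam"
    and nz: "kron lam mu nu \<noteq> 0"
  shows "0 \<le> excess m n (parts lam) (parts mu) (parts nu)"
    and "excess m n (parts lam) (parts mu) (parts nu) \<le> 0 \<Longrightarrow> matrix_sums m n (parts lam) (parts mu) (parts nu)"
proof -
  have sz: "sum_list lam = sum_list mu" "sum_list mu = sum_list nu"
    using nz by (auto simp: kron_def split: if_splits)
  have f: "partition_fun (length lam) (parts lam)" using lam by (simp add: partition_parts)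
  obtain w v B where w: "w permutes {..<m}" and v: "v permutes {..<n}"
    and B: "B \<in> tables {..<m} {..<n} (shift (parts mu) w) (shift (parts nu) v)"
    and nzB: "kostka (length lam) (parts lam) ({..<m} \<times> {..<n}) B \<noteq> 0"
  proof -
    let ?s = "\<lambda>w v. \<Sum>B\<in>tables {..<m} {..<n} (shift (parts mu) w) (shift (parts nu) v).
       kostka (length lam) (parts lam) ({..<m} \<times> {..<n}) B"
    have "(\<Sum>w | w permutes {..<m}. \<Sum>v | v permutes {..<n}. sign w * sign v * ?s w v) \<noteq> 0"
      using nz kron_eq_sum_kostka[OF sz] len by simp
    then obtain w where "w permutes {..<m}" "(\<Sum>v | v permutes {..<n}. sign w * sign v * ?s w v) \<noteq> 0"
      by (rule sum.not_neutral_contains_not_neutral) auto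
    moreover from this(2) obtain v where "v permutes {..<n}" "sign w * sign v * ?s w v \<noteq> 0"
      by (rule sum.not_neutral_contains_not_neutral) auto
    moreover from this(2) have "?s w v \<noteq> 0" by auto
    then obtain B where "B \<in> tables {..<m} {..<n} (shift (parts mu) w) (shift (parts nu) v)"
      "kostka (length lam) (parts lam) ({..<m} \<times> {..<n}) B \<noteq> 0"
      by (rule sum.not_neutral_contains_not_neutral)
    ultimately show ?thesis using that by blast
  qed
  note D = kostka_term_nonzeroD[OF mn f w v B nzB]
  show "0 \<le> excess m n (parts lam) (parts mu) (parts nu)" by (rule D(1))
  assume "excess m n (parts lam) (parts mu) (parts nu) \<le> 0"
  then have *: "w = id" "v = id" "\<And>t. t < m * n \<Longrightarrow> B (cell m n t) = parts lam t" using D(2) by auto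
  then have "B (i, j) = parts lam (idx m n i j)" if "i < m" "j < n" for i j
    using *(3)[of "idx m n i j"] that by (simp add: idx_less cell_idx)
  then show "matrix_sums m n (parts lam) (parts mu) (parts nu)"
    using B *(1,2) by (simp add: matrix_sums_def tables_def)
qed

lemma kron_eq_1:
  assumes mn: "m > 0" "n > 0" and len: "length lam = m * n" "length mu = m" "length nu = n"
    and lam: "is_part lam" and ms: "matrix_sums m n (parts lam) (parts mu) (parts nu)"
  shows "kron lam mu nu = 1"
proof -
  have sz: "sum_list lam = sum_list mu" "sum_list mu = sum_list nu"
    using matrix_sums_total[OF ms] sum_parts[of lam] sum_parts[of mu] sum_parts[of nu] len by auto
  have f: "partition_fun (m * n) (parts lam)" using lam len by (simp add: partition_parts)
  define A where "A = (\<lambda>(i, j)\<in>{..<m} \<times> {..<n}. parts lam (idx m n i j))"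
  let ?T = "\<lambda>w v. tables {..<m} {..<n} (shift (parts mu) w) (shift (parts nu) v)"
  let ?K = "kostka (m * n) (parts lam) ({..<m} \<times> {..<n})"
  have A: "A \<in> ?T id id"
    using ms by (auto simp: tables_def A_def matrix_sums_def parts_def)
  have only: "w = id \<and> v = id \<and> B = A"
    if w: "w permutes {..<m}" and v: "v permutes {..<n}" and B: "B \<in> ?T w v" and nz: "?K B \<noteq> 0" for w v B
  proof -
    have *: "w = id \<and> v = id \<and> (\<forall>t<m * n. B (cell m n t) = parts lam t)"
      using kostka_term_nonzeroD(2)[OF mn f w v B nz] excess_eq_0[OF ms] by simp
    have "B = A"
    proof (rule PiE_ext)
      show "B \<in> {..<m} \<times> {..<n} \<rightarrow>\<^sub>E {0..}" "A \<in> {..<m} \<times> {..<n} \<rightarrow>\<^sub>E {0..}"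
        using A B by (auto simp: tables_def)
      show "B c = A c" if "c \<in> {..<m} \<times> {..<n}" for c
      proof -
        obtain i j where c: "c = (i, j)" "i < m" "j < n" using \<open>c \<in> _\<close> by auto
        then show ?thesis
          using *[THEN conjunct2, THEN conjunct2, rule_format, of "idx m n i j"] by (simp add: A_def idx_less cell_idx)
      qed
    qed
    with * show ?thesis by simp
  qed
  have KA: "?K A = 1"
  proof -
    have "kostka (m * n) (parts lam) (cell m n ` {..<m * n}) A = 1"
    proof (rule kostka_self[OF f])
      show "inj_on (cell m n) {..<m * n}" using bij_betw_cell by (auto simp: bij_betw_def)
      show "parts lam i = 0" if "m * n \<le> i" for i using that len by (simp add: parts_def getd_def)
      show "A (cell m n t) = parts lam t" if "t < m * n" for t
        using cell_mem[OF that] idx_cell[OF that] by (auto simp: A_def case_prod_beta)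
    qed
    then show ?thesis using bij_betw_cell[of m n] by (simp add: bij_betw_def)
  qed
  have inner: "(\<Sum>B\<in>?T w v. ?K B) = (if w = id \<and> v = id then 1 else 0)"
    if w: "w permutes {..<m}" and v: "v permutes {..<n}" for w v
  proof (cases "w = id \<and> v = id")
    case True
    have "(\<Sum>B\<in>?T w v. ?K B) = (\<Sum>B\<in>{A}. ?K B)"
      using A only[OF w v] True by (intro sum.mono_neutral_right finite_tables) auto
    then show ?thesis using True KA by simp
  next
    case False
    then have "(\<Sum>B\<in>?T w v. ?K B) = 0"
      using only[OF w v] by (intro sum.neutral) blast
    then show ?thesis using False by simp
  qed
  have "kron lam mu nu = (\<Sum>w | w permutes {..<m}. \<Sum>v | v permutes {..<n}. sign w * sign v * (\<Sum>B\<in>?T w v. ?K B))"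
    using kron_eq_sum_kostka[OF sz] len by simp
  also have "\<dots> = (\<Sum>w | w permutes {..<m}. \<Sum>v | v permutes {..<n}. if v = id then if w = id then 1 else 0 else 0)"
    by (intro sum.cong refl) (auto simp: inner)
  also have "\<dots> = 1"
    by (simp add: finite_permutations permutes_id)
  finally show ?thesis .
qed

section \<open>Stability of Kronecker coefficients\<close>

lemma parts_padd_psmul: "parts (padd a (psmul k b)) i = parts a i + int k * parts b i"
  by (auto simp: parts_def padd_def psmul_def getd_def)

lemma length_padd_psmul: "length (padd a (psmul k b)) = max (length a) (length b)"
  by (simp add: padd_def psmul_def)

lemma sum_parts_ge:
  assumes "length xs \<le> l"
  shows "(\<Sum>i<l. parts xs i) = int (sum_list xs)"
proof -
  have "(\<Sum>i<length xs. parts xs i) = (\<Sum>i<l. parts xs i)"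
    using assms by (intro sum.mono_neutral_left) (auto simp: parts_def getd_def)
  then show ?thesis by (simp add: sum_parts)
qed

lemma sum_list_padd_psmul: "int (sum_list (padd a (psmul k b))) = int (sum_list a) + int k * int (sum_list b)"
proof -
  let ?l = "max (length a) (length b)"
  have "int (sum_list (padd a (psmul k b))) = (\<Sum>i<?l. parts (padd a (psmul k b)) i)"
    by (rule sum_parts_ge[symmetric]) (simp add: length_padd_psmul)
  also have "\<dots> = (\<Sum>i<?l. parts a i) + int k * (\<Sum>i<?l. parts b i)"
    by (simp add: parts_padd_psmul sum.distrib sum_distrib_left)
  finally show ?thesis by (simp add: sum_parts_ge)
qed

lemma partition_add_mult:
  assumes "partition_fun l f" "partition_fun l g"
  shows "partition_fun l (\<lambda>i. f i + int k * g i)"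
  using assms by (auto simp: partition_fun_def intro!: add_mono mult_left_mono)

text \<open>After subtracting \<open>k A\<close> from the tables, only finitely many of them,
  independently of \<open>k\<close>, have a nonzero Kostka number.\<close>
lemma ev_const_sum_kostka:
  fixes al lam be mu ga nu :: "nat \<Rightarrow> int"
  assumes mn: "m > 0" "n > 0" and pq: "m \<le> p" "n \<le> q"
    and al: "partition_fun l al" and lam: "partition_fun l lam" "\<And>i. m * n \<le> i \<Longrightarrow> lam i = 0"
    and ms: "matrix_sums m n lam mu nu" "\<And>i. m \<le> i \<Longrightarrow> mu i = 0" "\<And>j. n \<le> j \<Longrightarrow> nu j = 0"
  shows "ev_const (\<lambda>k. \<Sum>B\<in>tables {..<p} {..<q} (\<lambda>i. be i + int k * mu i) (\<lambda>j. ga j + int k * nu j).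
     kostka l (\<lambda>i. al i + int k * lam i) ({..<p} \<times> {..<q}) B)"
proof -
  let ?C = "{..<p} \<times> {..<q}"
  define f where "f k = (\<lambda>i. al i + int k * lam i)" for k
  define a where "a k = (\<lambda>i. be i + int k * mu i)" for k
  define b where "b k = (\<lambda>j. ga j + int k * nu j)" for k
  define A where "A c = (if c \<in> {..<m} \<times> {..<n} then lam (idx m n (fst c) (snd c)) else 0)" for c
  have le: "m * n \<le> p * q" using pq by (rule mult_le_mono)
  obtain e where e: "bij_betw e {..<p * q} ?C" "\<And>t. t < m * n \<Longrightarrow> e t = cell m n t"
    using enum_exists[OF pq] by blast
  have inj: "inj_on e {..<p * q}" and im: "e ` {..<p * q} = ?C"
    using e(1) by (auto simp: bij_betw_def)
  have Ae: "A (e t) = lam t" if "t < p * q" for t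
  proof (cases "t < m * n")
    case True
    then show ?thesis using cell_mem[OF True] idx_cell[OF True] by (simp add: A_def e(2))
  next
    case False
    then show ?thesis
      using bij_betw_enum_outside[OF e le _ that] lam(2)[of t] by (simp add: A_def)
  qed
  have A_row: "(\<Sum>j<q. A (i, j)) = mu i" for i
  proof (cases "i < m")
    case True
    have "(\<Sum>j<q. A (i, j)) = (\<Sum>j<n. A (i, j))"
      using pq by (intro sum.mono_neutral_right) (auto simp: A_def)
    then show ?thesis using True ms(1) by (simp add: A_def matrix_sums_def)
  qed (use ms(2) in \<open>simp add: A_def\<close>)
  have A_col: "(\<Sum>i<p. A (i, j)) = nu j" for j
  proof (cases "j < n")
    case True
    have "(\<Sum>i<p. A (i, j)) = (\<Sum>i<m. A (i, j))"
      using pq by (intro sum.mono_neutral_right) (auto simp: A_def)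
    then show ?thesis using True ms(1) by (simp add: A_def matrix_sums_def)
  qed (use ms(3) in \<open>simp add: A_def\<close>)
  \<comment> \<open>The constant part of the weight inequality; the multiples of k cancel because
    (lam, mu, nu) has zero excess.\<close>
  define X where "X = (\<Sum>t<m * n. al t * wt m n (cell m n t)) - (\<Sum>i<p. wx m n i * be i) - (\<Sum>j<q. wy m n j * ga j)"
  \<comment> \<open>In the corner an entry of \<open>D\<close> is al t plus a difference of two
    partial sums from [0, X]. Outside, the entries are nonnegative with sum at most the total of
    \<open>al\<close> plus \<open>X\<close>. Whenever some table contributes, \<open>X\<close> is
    nonnegative.\<close>
  define R where "R = (\<Sum>i<l. al i) + \<bar>X\<bar>"
  define Z where "Z = {D \<in> ?C \<rightarrow>\<^sub>E {-R..R}. (\<forall>i<p. (\<Sum>j<q. D (i, j)) = be i) \<and> (\<forall>j<q. (\<Sum>i<p. D (i, j)) = ga j)}"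
  define \<phi> where "\<phi> k D = (\<lambda>c\<in>?C. D c + int k * A c)" for k D
  let ?T = "\<lambda>k. tables {..<p} {..<q} (a k) (b k)"
  let ?K = "\<lambda>k. kostka l (f k) ?C"
  have finZ: "finite Z"
    unfolding Z_def by (rule finite_subset[of _ "?C \<rightarrow>\<^sub>E {-R..R}"]) (auto intro: finite_PiE)
  have pf: "partition_fun l (f k)" for k
    unfolding f_def using al lam(1) by (rule partition_add_mult)
  have al_le: "(\<Sum>i\<in>I. al i) \<le> (\<Sum>i<l. al i)" if "finite I" for I
  proof -
    have "(\<Sum>i\<in>I. al i) \<le> (\<Sum>i\<in>I \<union> {..<l}. al i)"
      using that partition_nonneg[OF al] by (intro sum_mono2) auto
    also have "\<dots> = (\<Sum>i<l. al i)"
      using that al by (intro sum.mono_neutral_right) (auto simp: partition_fun_def)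
    finally show ?thesis .
  qed
  have in_Z: "B \<in> \<phi> k ` Z" if B: "B \<in> ?T k" and nz: "?K k B \<noteq> 0" for k B
  proof
    define D where "D = (\<lambda>c\<in>?C. B c - int k * A c)"
    have Bext: "B \<in> ?C \<rightarrow>\<^sub>E {0..}" using B by (simp add: tables_def)
    show "B = \<phi> k D"
      using Bext by (auto simp: \<phi>_def D_def PiE_def extensional_def fun_eq_iff)
    have De: "f k t - B (e t) = al t - D (e t)" if "t < p * q" for t
      using that im Ae[OF that] by (auto simp: f_def D_def)
    define S where "S s = (\<Sum>t<s. al t - D (e t))" for s
    have S_eq: "(\<Sum>t<s. f k t - B (e t)) = S s" if "s \<le> p * q" for s
      unfolding S_def using De that by (intro sum.cong) auto
    have nz': "kostka l (f k) (e ` {..<p * q}) B \<noteq> 0" using nz by (simp add: im)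
    note KD = kostka_nonzeroD[OF pf inj nz']
    have S0: "0 \<le> S s" if "s \<le> p * q" for s
      using KD that by (simp add: sum_subtractf flip: S_eq)
    have Stot: "S (p * q) = 0" using KD by (simp add: sum_subtractf flip: S_eq)
    have "(\<Sum>t<m * n. S (Suc t)) = (\<Sum>t<m * n. \<Sum>s<Suc t. f k s - B (e s))"
      using le by (intro sum.cong refl S_eq[symmetric]) auto
    also have "\<dots> \<le> (\<Sum>t<m * n. f k t * wt m n (cell m n t)) - (\<Sum>i<p. wx m n i * a k i) - (\<Sum>j<q. wy m n j * b k j)"
      by (rule partial_sums_le_weight[OF mn(2) le pf e B nz])
    also have "\<dots> = X + int k * excess m n lam mu nu"
    proof -
      have "(\<Sum>i<p. wx m n i * mu i) = (\<Sum>i<m. wx m n i * mu i)"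
        "(\<Sum>j<q. wy m n j * nu j) = (\<Sum>j<n. wy m n j * nu j)"
        using pq by (intro sum.mono_neutral_right ballI; simp add: ms(2,3))+
      then show ?thesis
        by (simp add: X_def excess_def f_def a_def b_def algebra_simps sum.distrib flip: sum_distrib_left)
    qed
    also have "\<dots> = X" using excess_eq_0[OF ms(1)] by simp
    finally have SX: "(\<Sum>t<m * n. S (Suc t)) \<le> X" .
    have "0 \<le> (\<Sum>t<m * n. S (Suc t))" using le by (intro sum_nonneg S0) auto
    with SX have X0: "0 \<le> X" by simp
    have S1: "S s \<le> X" if "s \<le> m * n" for s
    proof (cases s)
      case (Suc t)
      then have "S (Suc t) \<le> (\<Sum>t<m * n. S (Suc t))"
        using that le by (intro member_le_sum S0) auto
      with SX Suc show ?thesis by simp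
    qed (use X0 in \<open>simp add: S_def\<close>)
    have "- R \<le> D (e t) \<and> D (e t) \<le> R" if t: "t < p * q" for t
    proof (cases "t < m * n")
      case True
      have "D (e t) = al t - S (Suc t) + S t" by (simp add: S_def)
      moreover have "0 \<le> al t" "al t \<le> (\<Sum>i<l. al i)"
        using partition_nonneg[OF al] al_le[of "{t}"] by auto
      moreover have "0 \<le> (\<Sum>i<l. al i)" using partition_nonneg[OF al] by (intro sum_nonneg) auto
      moreover have "0 \<le> S (Suc t)" "S (Suc t) \<le> X" "0 \<le> S t" "S t \<le> X"
        using True le S0[of "Suc t"] S1[of "Suc t"] S0[of t] S1[of t] by auto
      ultimately show ?thesis using X0 by (simp add: R_def)
    next
      case False
      have Dnn: "0 \<le> D (e s)" if "s \<in> {m * n..<p * q}" for s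
      proof -
        have "e s \<in> ?C" unfolding im[symmetric] using that by (intro imageI) simp
        moreover have "D (e s) = B (e s)"
          using \<open>e s \<in> ?C\<close> Ae[of s] lam(2)[of s] that by (simp add: D_def)
        ultimately show ?thesis using Bext by (auto simp: PiE_def Pi_def)
      qed
      have "D (e t) \<le> (\<Sum>s\<in>{m * n..<p * q}. D (e s))"
        using False t Dnn by (intro member_le_sum) auto
      also have "\<dots> = (\<Sum>s\<in>{m * n..<p * q}. al s) + S (m * n)"
      proof -
        have "{..<p * q} = {..<m * n} \<union> {m * n..<p * q}" using le by auto
        then have "S (p * q) = S (m * n) + (\<Sum>s\<in>{m * n..<p * q}. al s - D (e s))"
          unfolding S_def by (simp add: sum.union_disjoint ivl_disj_int)
        with Stot show ?thesis by (simp add: sum_subtractf)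
      qed
      also have "\<dots> \<le> R" using al_le[of "{m * n..<p * q}"] S1[of "m * n"] X0 by (simp add: R_def)
      finally have "D (e t) \<le> R" .
      moreover have "0 \<le> D (e t)" using False t Dnn by simp
      moreover have "0 \<le> (\<Sum>i<l. al i)" using partition_nonneg[OF al] by (intro sum_nonneg) auto
      ultimately show ?thesis by (simp add: R_def)
    qed
    then have "- R \<le> D c \<and> D c \<le> R" if "c \<in> ?C" for c
      using that unfolding im[symmetric] by blast
    then have "D \<in> ?C \<rightarrow>\<^sub>E {-R..R}" by (auto simp: D_def)
    moreover have "(\<Sum>j<q. D (i, j)) = be i" if "i < p" for i
    proof -
      have "(\<Sum>j<q. D (i, j)) = (\<Sum>j<q. B (i, j)) - int k * (\<Sum>j<q. A (i, j))"
        using that by (simp add: D_def sum_subtractf sum_distrib_left)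
      then show ?thesis using B that A_row by (simp add: tables_def a_def)
    qed
    moreover have "(\<Sum>i<p. D (i, j)) = ga j" if "j < q" for j
    proof -
      have "(\<Sum>i<p. D (i, j)) = (\<Sum>i<p. B (i, j)) - int k * (\<Sum>i<p. A (i, j))"
        using that by (simp add: D_def sum_subtractf sum_distrib_left)
      then show ?thesis using B that A_col by (simp add: tables_def b_def)
    qed
    ultimately show "D \<in> Z" by (simp add: Z_def)
  qed
  \<comment> \<open>The margins are correct for every k, so only the signs of the entries are in
    question. The form 0 + int k * 0 makes each condition an instance of
    \<open>ev_decided_linear_le\<close>.\<close>
  have T_iff: "\<phi> k D \<in> ?T k \<longleftrightarrow> (\<forall>c\<in>?C. 0 + int k * 0 \<le> D c + int k * A c)" if D: "D \<in> Z" for k D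
  proof -
    have "(\<Sum>j<q. \<phi> k D (i, j)) = a k i" if "i < p" for i
      using D that A_row[of i] by (simp add: \<phi>_def a_def Z_def sum.distrib flip: sum_distrib_left)
    moreover have "(\<Sum>i<p. \<phi> k D (i, j)) = b k j" if "j < q" for j
      using D that A_col[of j] by (simp add: \<phi>_def b_def Z_def sum.distrib flip: sum_distrib_left)
    moreover have "\<phi> k D \<in> ?C \<rightarrow>\<^sub>E {0..} \<longleftrightarrow> (\<forall>c\<in>?C. 0 + int k * 0 \<le> D c + int k * A c)"
      by (auto simp: \<phi>_def PiE_def Pi_def)
    ultimately show ?thesis unfolding tables_def by auto
  qed
  have "(\<Sum>B\<in>?T k. ?K k B) = (\<Sum>D\<in>Z. if \<phi> k D \<in> ?T k then ?K k (\<phi> k D) else 0)" for k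
  proof -
    have "(\<Sum>B\<in>?T k. ?K k B) = (\<Sum>B\<in>\<phi> k ` Z \<inter> ?T k. ?K k B)"
      using in_Z by (intro sum.mono_neutral_right finite_tables) auto
    also have "\<dots> = (\<Sum>B\<in>\<phi> k ` Z. if B \<in> ?T k then ?K k B else 0)"
      using finZ by (intro sum.inter_restrict) auto
    also have "\<dots> = (\<Sum>D\<in>Z. if \<phi> k D \<in> ?T k then ?K k (\<phi> k D) else 0)"
    proof (rule sum.reindex_cong[OF _ refl refl])
      show "inj_on (\<phi> k) Z"
      proof (rule inj_onI)
        fix D E assume D: "D \<in> Z" and E: "E \<in> Z" and eq: "\<phi> k D = \<phi> k E"
        show "D = E"
        proof (rule PiE_ext)
          show "D \<in> ?C \<rightarrow>\<^sub>E {-R..R}" "E \<in> ?C \<rightarrow>\<^sub>E {-R..R}" using D E by (simp_all add: Z_def)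
          show "D c = E c" if "c \<in> ?C" for c
            using fun_cong[OF eq, of c] that by (simp add: \<phi>_def)
        qed
      qed
    qed
    finally show ?thesis .
  qed
  moreover have "ev_const (\<lambda>k. \<Sum>D\<in>Z. if \<phi> k D \<in> ?T k then ?K k (\<phi> k D) else 0)"
  proof (intro ev_const_sum ev_const_if)
    fix D assume D: "D \<in> Z"
    show "ev_decided (\<lambda>k. \<phi> k D \<in> ?T k)"
      unfolding T_iff[OF D] by (intro ev_decided_Ball ev_decided_linear_le) auto
    have "ev_const (\<lambda>k. kostka l (\<lambda>i. al i + int k * lam i) (e ` {..<p * q}) (\<lambda>c. D c + int k * A c))"
    proof (rule kostka_stable[OF inj])
      show "lam i = 0" if "p * q \<le> i" for i using lam(2) that le by simp
      show "\<forall>\<^sub>F k in sequentially. partition_fun l (\<lambda>i. al i + int k * lam i)"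
        using pf by (simp add: f_def)
    qed (rule Ae)
    moreover have "?K k (\<phi> k D) = kostka l (\<lambda>i. al i + int k * lam i) (e ` {..<p * q}) (\<lambda>c. D c + int k * A c)" for k
      unfolding im f_def by (rule kostka_cong) (auto simp: \<phi>_def)
    ultimately show "ev_const (\<lambda>k. ?K k (\<phi> k D))" by simp
  qed
  ultimately show ?thesis by (simp add: f_def a_def b_def)
qed

text \<open>\<open>shift\<close> acts on \<open>be\<close> and \<open>ga\<close> alone, so for each
  pair (w, v) the margins are affine in k, and the set of pairs does not depend on k. If the sizes
  of \<open>al\<close>, \<open>be\<close>, \<open>ga\<close> disagree, every coefficient is
  zero.\<close>

theorem kron_stable:
  assumes mn: "m > 0" "n > 0" and len: "length lam = m * n" "length mu = m" "length nu = n"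
    and lam: "is_part lam" and ms: "matrix_sums m n (parts lam) (parts mu) (parts nu)"
    and al: "is_part al"
  shows "ev_const (\<lambda>k. kron (padd al (psmul k lam)) (padd be (psmul k mu)) (padd ga (psmul k nu)))"
proof (cases "sum_list al = sum_list be \<and> sum_list be = sum_list ga")
  case sz: True
  define l p q where "l = max (length al) (m * n)" and "p = max (length be) m" and "q = max (length ga) n"
  have szk: "sum_list lam = sum_list mu" "sum_list mu = sum_list nu"
    using matrix_sums_total[OF ms] sum_parts[of lam] sum_parts[of mu] sum_parts[of nu] len by auto
  have sh: "shift (\<lambda>i. parts x i + int k * parts y i) w = (\<lambda>i. shift (parts x) w i + int k * parts y i)" for x y k w
    by (simp add: fun_eq_iff shift_def)
  have "kron (padd al (psmul k lam)) (padd be (psmul k mu)) (padd ga (psmul k nu)) =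
     (\<Sum>w | w permutes {..<p}. \<Sum>v | v permutes {..<q}. sign w * sign v *
      (\<Sum>B\<in>tables {..<p} {..<q} (\<lambda>i. shift (parts be) w i + int k * parts mu i) (\<lambda>j. shift (parts ga) v j + int k * parts nu j).
        kostka l (\<lambda>i. parts al i + int k * parts lam i) ({..<p} \<times> {..<q}) B))" for k
  proof -
    have "sum_list (padd al (psmul k lam)) = sum_list (padd be (psmul k mu))"
      "sum_list (padd be (psmul k mu)) = sum_list (padd ga (psmul k nu))"
      using sz szk sum_list_padd_psmul[of al k lam] sum_list_padd_psmul[of be k mu] sum_list_padd_psmul[of ga k nu]
      by simp_all
    from kron_eq_sum_kostka[OF this] show ?thesis
      unfolding parts_padd_psmul[abs_def] sh length_padd_psmul len l_def p_def q_def .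
  qed
  moreover have "ev_const (\<lambda>k. \<Sum>w | w permutes {..<p}. \<Sum>v | v permutes {..<q}. sign w * sign v *
      (\<Sum>B\<in>tables {..<p} {..<q} (\<lambda>i. shift (parts be) w i + int k * parts mu i) (\<lambda>j. shift (parts ga) v j + int k * parts nu j).
        kostka l (\<lambda>i. parts al i + int k * parts lam i) ({..<p} \<times> {..<q}) B))"
  proof (intro ev_const_sum ev_const_mult ev_const_sum_kostka[OF mn _ _ _ _ _ ms])
    show "partition_fun l (parts al)" "partition_fun l (parts lam)"
      using al lam len by (auto intro!: partition_parts simp: l_def)
  qed (auto simp: p_def q_def parts_def getd_def len)
  ultimately show ?thesis by simp
next
  case False
  have szk: "sum_list lam = sum_list mu" "sum_list mu = sum_list nu"
    using matrix_sums_total[OF ms] sum_parts[of lam] sum_parts[of mu] sum_parts[of nu] len by auto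
  have "kron (padd al (psmul k lam)) (padd be (psmul k mu)) (padd ga (psmul k nu)) = 0" for k
    using False szk sum_list_padd_psmul[of al k lam] sum_list_padd_psmul[of be k mu] sum_list_padd_psmul[of ga k nu]
    by (auto simp: kron_def)
  then show ?thesis by simp
qed

section \<open>The cone\<close>

lemma partition_fun_iff:
  "partition_fun l f \<longleftrightarrow> (\<forall>i\<ge>l. f i = 0) \<and> (\<forall>i. Suc i < l \<longrightarrow> f (Suc i) \<le> f i) \<and> (l > 0 \<longrightarrow> f (l - 1) \<ge> 0)"
proof
  assume f: "partition_fun l f"
  then show "(\<forall>i\<ge>l. f i = 0) \<and> (\<forall>i. Suc i < l \<longrightarrow> f (Suc i) \<le> f i) \<and> (l > 0 \<longrightarrow> f (l - 1) \<ge> 0)"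
    using partition_nonneg[OF f] by (simp add: partition_fun_def)
next
  assume *: "(\<forall>i\<ge>l. f i = 0) \<and> (\<forall>i. Suc i < l \<longrightarrow> f (Suc i) \<le> f i) \<and> (l > 0 \<longrightarrow> f (l - 1) \<ge> 0)"
  have "f (Suc i) \<le> f i" for i
  proof -
    consider "Suc i < l" | "l = Suc i" | "l \<le> i" by linarith
    then show ?thesis by cases (use * in auto)
  qed
  with * show "partition_fun l f" by (simp add: partition_fun_def)
qed

lemma tau_iff:
  assumes "m > 0" "n > 0"
  shows "(x, y, z) \<in> tau m n \<longleftrightarrow>
    partition_fun (m * n) x \<and> partition_fun m y \<and> partition_fun n z \<and> matrix_sums m n x y z"
  unfolding tau_def partition_fun_iff supp_in_def using star_eqs_iff[OF assms, of x y z]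
  by (auto simp: matrix_sums_def)

lemma tau_zero:
  assumes "m > 0" "n > 0"
  shows "0 \<in> tau m n"
proof -
  have "(0, 0, 0) \<in> tau m n"
    unfolding tau_iff[OF assms] partition_fun_def matrix_sums_def by simp
  then show ?thesis unfolding zero_prod_def .
qed

lemma partition_fun_add: "partition_fun l f \<Longrightarrow> partition_fun l g \<Longrightarrow> partition_fun l (f + g)"
  by (simp add: partition_fun_def add_mono)

lemma matrix_sums_add:
  "matrix_sums m n f g h \<Longrightarrow> matrix_sums m n f' g' h' \<Longrightarrow> matrix_sums m n (f + f') (g + g') (h + h')"
  by (simp add: matrix_sums_def sum.distrib)

lemma tau_add:
  assumes "m > 0" "n > 0" "p \<in> tau m n" "p' \<in> tau m n"
  shows "p + p' \<in> tau m n"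
proof -
  obtain x y z x' y' z' where p: "p = (x, y, z)" "p' = (x', y', z')" by (cases p; cases p') auto
  show ?thesis
    using assms(3,4) unfolding p add_Pair tau_iff[OF assms(1,2)]
    by (blast intro: partition_fun_add matrix_sums_add)
qed

lemma tau_scaleR:
  assumes "m > 0" "n > 0" "p \<in> tau m n" "r \<ge> 0"
  shows "r *\<^sub>R p \<in> tau m n"
proof -
  obtain x y z where p: "p = (x, y, z)" by (cases p) auto
  show ?thesis
    using assms(3,4) unfolding p scaleR_Pair tau_iff[OF assms(1,2)]
    by (auto simp: scaleR_fun_def partition_fun_def matrix_sums_def sum_distrib_left intro: mult_left_mono)
qed

lemma tau_sum:
  assumes "m > 0" "n > 0" "\<And>k. k \<in> F \<Longrightarrow> p k \<in> tau m n"
  shows "(\<Sum>k\<in>F. p k) \<in> tau m n"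
  using assms(3) by (induction F rule: infinite_finite_induct) (auto intro: tau_zero tau_add assms(1,2))

text \<open>The equations recover the margins from the matrix, so \<lambda> alone parametrises the
  cone.\<close>

lemma tau_eqI:
  assumes mn: "m > 0" "n > 0" and p: "p \<in> tau m n" "p' \<in> tau m n" and eq: "fst p = fst p'"
  shows "p = p'"
proof -
  obtain x y z y' z' where pp: "p = (x, y, z)" "p' = (x, y', z')"
    using eq by (cases p; cases p') auto
  have "y i = y' i" for i
    using p unfolding pp tau_iff[OF mn] by (cases "i < m") (auto simp: matrix_sums_def partition_fun_def)
  moreover have "z i = z' i" for i
    using p unfolding pp tau_iff[OF mn] by (cases "i < n") (auto simp: matrix_sums_def partition_fun_def)
  ultimately show ?thesis by (auto simp: pp)
qed

lemma vec_of_eq: "vec_of xs i = real_of_int (parts xs i)"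
  by (simp add: vec_of_def parts_def getd_def)

lemma partition_fun_vec_of: "is_part xs \<Longrightarrow> length xs = l \<Longrightarrow> partition_fun l (vec_of xs)"
  using partition_parts[of xs l] by (simp add: partition_fun_def vec_of_eq)

lemma matrix_sums_vec_of:
  "matrix_sums m n (vec_of lam) (vec_of mu) (vec_of nu) \<longleftrightarrow> matrix_sums m n (parts lam) (parts mu) (parts nu)"
  unfolding matrix_sums_def vec_of_eq of_int_sum[symmetric] of_int_eq_iff ..

lemma matrix_sums_parts_iff_star_eqs:
  assumes "m > 0" "n > 0"
  shows "star_eqs m n (at1 lam) (at1 mu) (at1 nu) \<longleftrightarrow> matrix_sums m n (parts lam) (parts mu) (parts nu)"
proof -
  have "at1 xs = (\<lambda>i. getd xs (i - 1))" for xs by (simp add: at1_def fun_eq_iff)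
  then have "star_eqs m n (at1 lam) (at1 mu) (at1 nu) \<longleftrightarrow> matrix_sums m n (getd lam) (getd mu) (getd nu)"
    using star_eqs_iff[OF assms, of "getd lam" "getd mu" "getd nu"] by (simp add: matrix_sums_def)
  then show ?thesis
    unfolding matrix_sums_def parts_def of_nat_sum[symmetric] of_nat_eq_iff .
qed

text \<open>The equations are homogeneous, so \<open>kron_eq_1\<close> applies to every
  multiple.\<close>

lemma weakly_stable_if_matrix_sums:
  assumes mn: "m > 0" "n > 0" and len: "length lam = m * n" "length mu = m" "length nu = n"
    and lam: "is_part lam" and ms: "matrix_sums m n (parts lam) (parts mu) (parts nu)"
  shows "weakly_stable lam mu nu"
  unfolding weakly_stable_def
proof (intro allI impI)
  fix k :: nat
  have ps: "parts (psmul k xs) = (\<lambda>i. int k * parts xs i)" for xs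
    by (auto simp: parts_def psmul_def getd_def)
  show "kron (psmul k lam) (psmul k mu) (psmul k nu) = 1"
  proof (rule kron_eq_1[OF mn])
    show "is_part (psmul k lam)"
      using lam by (auto simp: is_part_def psmul_def sorted_wrt_map intro: sorted_wrt_mono_rel[rotated])
    show "matrix_sums m n (parts (psmul k lam)) (parts (psmul k mu)) (parts (psmul k nu))"
      using ms by (simp add: ps matrix_sums_def sum_distrib_left)
  qed (use len in \<open>simp_all add: psmul_def\<close>)
qed

lemma emb_in_tau:
  assumes "m > 0" "n > 0" "part_len (m * n) lam" "part_len m mu" "part_len n nu"
    "matrix_sums m n (parts lam) (parts mu) (parts nu)"
  shows "emb (lam, mu, nu) \<in> tau m n"
  using assms by (simp add: emb_def tau_iff part_len_def partition_fun_vec_of matrix_sums_vec_of)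

section \<open>Generated cones and the excess as a linear form\<close>

lemma gen_cone_zero: "0 \<in> gen_cone S"
  unfolding gen_cone_def mem_Collect_eq by (intro exI[of _ "{}"] exI[of _ "\<lambda>_. 0"]) simp

lemma gen_cone_scaleR: "v \<in> S \<Longrightarrow> r \<ge> 0 \<Longrightarrow> r *\<^sub>R v \<in> gen_cone S"
  unfolding gen_cone_def mem_Collect_eq by (intro exI[of _ "{v}"] exI[of _ "\<lambda>_. r"]) simp

text \<open>Common generators get their coefficients added, so combinations over index families can
  be formed even if generators repeat.\<close>

lemma gen_cone_add:
  assumes "p \<in> gen_cone S" "p' \<in> gen_cone S"
  shows "p + p' \<in> gen_cone S"
proof -
  obtain F c where F: "finite F" "F \<subseteq> S" "\<forall>v\<in>F. c v \<ge> 0" "p = (\<Sum>v\<in>F. c v *\<^sub>R v)"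
    using assms(1) by (auto simp: gen_cone_def)
  obtain F' c' where F': "finite F'" "F' \<subseteq> S" "\<forall>v\<in>F'. c' v \<ge> 0" "p' = (\<Sum>v\<in>F'. c' v *\<^sub>R v)"
    using assms(2) by (auto simp: gen_cone_def)
  define d where "d v = (if v \<in> F then c v else 0) + (if v \<in> F' then c' v else 0)" for v
  have "p = (\<Sum>v\<in>F \<union> F'. (if v \<in> F then c v else 0) *\<^sub>R v)"
    unfolding F(4) using F(1) F'(1) by (intro sum.mono_neutral_cong_left) auto
  moreover have "p' = (\<Sum>v\<in>F \<union> F'. (if v \<in> F' then c' v else 0) *\<^sub>R v)"
    unfolding F'(4) using F(1) F'(1) by (intro sum.mono_neutral_cong_left) auto
  ultimately have "p + p' = (\<Sum>v\<in>F \<union> F'. d v *\<^sub>R v)"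
    by (simp add: d_def scaleR_add_left sum.distrib)
  moreover have "\<forall>v\<in>F \<union> F'. d v \<ge> 0" using F(3) F'(3) by (auto simp: d_def)
  ultimately show ?thesis
    unfolding gen_cone_def using F(1,2) F'(1,2) by blast
qed

lemma gen_cone_sum:
  "(\<And>k. k \<in> K \<Longrightarrow> p k \<in> gen_cone S) \<Longrightarrow> (\<Sum>k\<in>K. p k) \<in> gen_cone S"
  by (induction K rule: infinite_finite_induct) (auto intro: gen_cone_zero gen_cone_add)

definition excess_pt :: "nat \<Rightarrow> nat \<Rightarrow> pt \<Rightarrow> real" where
  "excess_pt m n p = (case p of (x, y, z) \<Rightarrow> excess m n x y z)"

lemma excess_pt_add: "excess_pt m n (p + p') = excess_pt m n p + excess_pt m n p'"
  by (cases p; cases p') (simp add: excess_pt_def excess_def sum.distrib algebra_simps)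

lemma excess_pt_scaleR: "excess_pt m n (r *\<^sub>R p) = r * excess_pt m n p"
  by (cases p) (simp add: excess_pt_def excess_def scaleR_fun_def sum_distrib_left algebra_simps)

lemma excess_pt_sum: "excess_pt m n (\<Sum>k\<in>F. p k) = (\<Sum>k\<in>F. excess_pt m n (p k))"
proof -
  have "excess_pt m n 0 = 0" using excess_pt_scaleR[of m n 0 0] by simp
  then show ?thesis by (induction F rule: infinite_finite_induct) (auto simp: excess_pt_add)
qed

lemma excess_pt_emb: "excess_pt m n (emb (lam, mu, nu)) = of_int (excess m n (parts lam) (parts mu) (parts nu))"
  by (simp add: excess_pt_def emb_def excess_def vec_of_eq)

lemma excess_pt_tau:
  assumes "m > 0" "n > 0" "p \<in> tau m n"
  shows "excess_pt m n p = 0"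
proof -
  obtain x y z where "p = (x, y, z)" by (cases p)
  then show ?thesis using assms by (simp add: tau_iff excess_eq_0 excess_pt_def)
qed

lemma excess_pt_KronSG:
  assumes mn: "m > 0" "n > 0" and v: "v \<in> emb ` KronSG (m * n) m n"
  shows "0 \<le> excess_pt m n v" and "excess_pt m n v = 0 \<Longrightarrow> v \<in> tau m n"
proof -
  obtain lam mu nu where v: "v = emb (lam, mu, nu)" and pl: "part_len (m * n) lam" "part_len m mu" "part_len n nu"
    and nz: "kron lam mu nu \<noteq> 0"
    using v by (auto simp: KronSG_def)
  note D = kron_nonzeroD[OF mn, of mu nu lam]
  show "0 \<le> excess_pt m n v" using D(1) pl nz by (simp add: v excess_pt_emb part_len_def)
  assume "excess_pt m n v = 0"
  then have "matrix_sums m n (parts lam) (parts mu) (parts nu)"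
    using D(2) pl nz by (simp add: v excess_pt_emb part_len_def)
  then show "v \<in> tau m n" unfolding v by (rule emb_in_tau[OF mn pl])
qed

text \<open>A nonnegative combination has zero excess only if each generator with positive
  coefficient does, and such generators lie in \<open>tau\<close>.\<close>

lemma excess_pt_PKron:
  assumes mn: "m > 0" "n > 0" and p: "p \<in> PKron (m * n) m n"
  shows "0 \<le> excess_pt m n p" and "excess_pt m n p = 0 \<Longrightarrow> p \<in> tau m n"
proof -
  obtain F c where F: "finite F" "F \<subseteq> emb ` KronSG (m * n) m n" "\<forall>v\<in>F. c v \<ge> 0"
    and p: "p = (\<Sum>v\<in>F. c v *\<^sub>R v)"
    using p by (auto simp: PKron_def gen_cone_def)
  have ex: "excess_pt m n p = (\<Sum>v\<in>F. c v * excess_pt m n v)"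
    by (simp add: p excess_pt_sum excess_pt_scaleR)
  have nn: "0 \<le> c v * excess_pt m n v" if "v \<in> F" for v
    using that F excess_pt_KronSG(1)[OF mn, of v] by (intro mult_nonneg_nonneg) auto
  show "0 \<le> excess_pt m n p" unfolding ex using nn by (rule sum_nonneg)
  assume "excess_pt m n p = 0"
  then have z: "c v * excess_pt m n v = 0" if "v \<in> F" for v
    using sum_nonneg_eq_0_iff[OF F(1), of "\<lambda>v. c v * excess_pt m n v"] nn that by (simp add: ex)
  show "p \<in> tau m n"
    unfolding p
  proof (rule tau_sum[OF mn])
    fix v assume v: "v \<in> F"
    show "c v *\<^sub>R v \<in> tau m n"
    proof (cases "c v = 0")
      case True
      then show ?thesis using tau_zero[OF mn] by simp
    next
      case False
      then have "v \<in> tau m n" using z[OF v] excess_pt_KronSG(2)[OF mn, of v] v F(2) by auto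
      then show ?thesis using F(3) v by (intro tau_scaleR[OF mn]) auto
    qed
  qed
qed

definition row_sums :: "nat \<Rightarrow> nat \<Rightarrow> nat list \<Rightarrow> nat list" where
  "row_sums m n lam = map (\<lambda>i. \<Sum>j<n. getd lam (idx m n i j)) [0..<m]"

definition col_sums :: "nat \<Rightarrow> nat \<Rightarrow> nat list \<Rightarrow> nat list" where
  "col_sums m n lam = map (\<lambda>j. \<Sum>i<m. getd lam (idx m n i j)) [0..<n]"

text \<open>A partition written in this order decreases along rows and columns, so its margins are
  partitions.\<close>

lemma idx_mono:
  assumes "i \<le> i'" "i' < m" "j \<le> j'"
  shows "idx m n i j \<le> idx m n i' j'"
proof (cases "j = 0")
  case True
  have "i \<le> m + i' * (n - 1) + (j' - 1)" using assms by (simp add: trans_le_add1)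
  then show ?thesis using True assms(1) by (simp only: idx_def if_True simp_thms split: if_split)
next
  case False
  have "m + i * (n - 1) + (j - 1) \<le> m + i' * (n - 1) + (j' - 1)"
    using assms by (intro add_mono mult_le_mono1 diff_le_mono) auto
  moreover have "j' \<noteq> 0" using False assms by simp
  ultimately show ?thesis using False by (simp only: idx_def if_False)
qed

lemma getd_antimono: "is_part xs \<Longrightarrow> i \<le> j \<Longrightarrow> getd xs j \<le> getd xs i"
  using partition_antimono[OF partition_parts[OF _ le_refl], of xs i j] by (simp add: parts_def)

lemma part_len_map_upt:
  assumes "\<And>i j. i < j \<Longrightarrow> j < l \<Longrightarrow> g j \<le> g i"
  shows "part_len l (map g [0..<l])"
  using assms by (auto simp: part_len_def is_part_def sorted_wrt_iff_nth_less)

lemma part_len_row_sums: "is_part lam \<Longrightarrow> part_len m (row_sums m n lam)"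
  unfolding row_sums_def by (auto intro!: part_len_map_upt sum_mono getd_antimono idx_mono)

lemma part_len_col_sums: "is_part lam \<Longrightarrow> part_len n (col_sums m n lam)"
  unfolding col_sums_def by (auto intro!: part_len_map_upt sum_mono getd_antimono idx_mono)

lemma matrix_sums_row_col_sums: "matrix_sums m n (parts lam) (parts (row_sums m n lam)) (parts (col_sums m n lam))"
proof -
  have "getd (map g [0..<l]) i = g i" if "i < l" for g l i
    using that by (simp add: getd_def)
  then show ?thesis by (auto simp: matrix_sums_def parts_def row_sums_def col_sums_def)
qed

text \<open>The cone \<open>\<tau>\<close> is simplicial: its rays are the triples with \<open>\<lambda> = (1, \<dots>, 1, 0, \<dots>, 0)\<close>.\<close>
lemma tau_subset_PKron:
  assumes mn: "m > 0" "n > 0"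
  shows "tau m n \<subseteq> PKron (m * n) m n"
proof
  fix p assume p: "p \<in> tau m n"
  obtain x y z where pxyz: "p = (x, y, z)" by (cases p)
  have x: "partition_fun (m * n) x" using p by (simp add: pxyz tau_iff[OF mn])
  define L where "L k = map (\<lambda>i. if i < k then 1 else 0 :: nat) [0..<m * n]" for k
  define T where "T k = (L k, row_sums m n (L k), col_sums m n (L k))" for k
  \<comment> \<open>The coordinates of \<open>p\<close> in the rays: summed over k from i + 1 to m *
    n they telescope to x i, as x (m * n) = 0.\<close>
  define c where "c k = x (k - 1) - x k" for k
  have L: "part_len (m * n) (L k)" for k
    unfolding L_def by (rule part_len_map_upt) auto
  have c0: "0 \<le> c k" for k
    using partition_antimono[OF x, of "k - 1" k] by (simp add: c_def)
  have T_tau: "emb (T k) \<in> tau m n" for k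
    using L[of k] unfolding T_def
    by (intro emb_in_tau[OF mn] part_len_row_sums part_len_col_sums matrix_sums_row_col_sums)
      (auto simp: part_len_def)
  \<comment> \<open>The rays themselves satisfy the equations, so \<open>kron_eq_1\<close> makes
    them generators of \<open>PKron\<close>.\<close>
  have T_SG: "T k \<in> KronSG (m * n) m n" for k
  proof -
    have "kron (L k) (row_sums m n (L k)) (col_sums m n (L k)) = 1"
      using L[of k] part_len_row_sums part_len_col_sums
      by (intro kron_eq_1[OF mn] matrix_sums_row_col_sums) (auto simp: part_len_def row_sums_def col_sums_def)
    then show ?thesis
      using L[of k] by (auto simp: T_def KronSG_def part_len_def[of _ "L k"] intro: part_len_row_sums part_len_col_sums)
  qed
  let ?s = "\<Sum>k\<in>{1..m * n}. c k *\<^sub>R emb (T k)"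
  have "p = ?s"
  proof (rule tau_eqI[OF mn p])
    show "?s \<in> tau m n"
      using c0 T_tau by (intro tau_sum[OF mn] tau_scaleR[OF mn]) auto
    have fs: "fst (\<Sum>k\<in>K. g k) i = (\<Sum>k\<in>K. fst (g k) i)" for K i and g :: "nat \<Rightarrow> pt"
      by (induction K rule: infinite_finite_induct) auto
    have "x i = fst ?s i" for i
    proof -
      have "fst ?s i = (\<Sum>k\<in>{1..m * n}. if i < k then c k else 0)"
        unfolding fs by (intro sum.cong) (auto simp: T_def emb_def scaleR_fun_def vec_of_def L_def)
      also have "\<dots> = (\<Sum>k\<in>{Suc i..m * n}. c k)"
        by (rule sum.mono_neutral_cong_right) auto
      also have "\<dots> = x i"
      proof (cases "i < m * n")
        case True
        then have "(\<Sum>k\<in>{Suc i..m * n}. c k) = - (\<Sum>k\<in>{Suc i..m * n}. x k - x (k - 1))"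
          by (simp add: c_def flip: sum_negf)
        also have "(\<Sum>k\<in>{Suc i..m * n}. x k - x (k - 1)) = x (m * n) - x i"
          using True sum_telescope''[of i "m * n" x] by simp
        finally show ?thesis using x by (simp add: partition_fun_def)
      qed (use x in \<open>auto simp: partition_fun_def\<close>)
      finally show ?thesis by simp
    qed
    then show "fst p = fst ?s" by (auto simp: pxyz)
  qed
  also have "\<dots> \<in> PKron (m * n) m n"
    unfolding PKron_def using c0 T_SG by (intro gen_cone_sum gen_cone_scaleR) auto
  finally show "p \<in> PKron (m * n) m n" .
qed

lemma tau_face_of_PKron:
  assumes mn: "m > 0" "n > 0"
  shows "tau m n face_of PKron (m * n) m n"
  unfolding face_of_def
proof (intro conjI ballI impI)
  show "tau m n \<subseteq> PKron (m * n) m n" by (rule tau_subset_PKron[OF mn])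
  show "convex (tau m n)"
    unfolding convex_def by (auto intro!: tau_add[OF mn] tau_scaleR[OF mn])
next
  fix a b x
  assume a: "a \<in> PKron (m * n) m n" and b: "b \<in> PKron (m * n) m n" and x: "x \<in> tau m n"
    and seg: "x \<in> open_segment a b"
  obtain u where u: "0 < u" "u < 1" "x = (1 - u) *\<^sub>R a + u *\<^sub>R b"
    using seg by (auto simp: in_segment)
  \<comment> \<open>Both coefficients are positive and both values nonnegative, so a zero inside the
    segment forces zeros at its ends.\<close>
  have "(1 - u) * excess_pt m n a + u * excess_pt m n b = 0"
    using excess_pt_tau[OF mn x] unfolding u(3) by (simp add: excess_pt_add excess_pt_scaleR)
  moreover have "0 \<le> excess_pt m n a" "0 \<le> excess_pt m n b"
    using excess_pt_PKron(1)[OF mn] a b by auto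
  then have "0 \<le> (1 - u) * excess_pt m n a" "0 \<le> u * excess_pt m n b" using u by auto
  ultimately have "(1 - u) * excess_pt m n a = 0" "u * excess_pt m n b = 0" by linarith+
  then have "excess_pt m n a = 0" "excess_pt m n b = 0" using u by auto
  then show "a \<in> tau m n" "b \<in> tau m n" using excess_pt_PKron(2)[OF mn] a b by auto
qed

lemma integral_partition_fun:
  fixes x :: "nat \<Rightarrow> real"
  assumes x: "partition_fun l x" "\<And>i. x i \<in> \<int>"
  obtains xs where "part_len l xs" "vec_of xs = x"
proof
  define xs where "xs = map (\<lambda>i. nat \<lfloor>x i\<rfloor>) [0..<l]"
  show "part_len l xs"
    unfolding xs_def using partition_antimono[OF x(1)] by (intro part_len_map_upt nat_mono floor_mono) auto
  have "real (nat \<lfloor>x i\<rfloor>) = x i" for i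
    using x(2)[of i] partition_nonneg[OF x(1), of i] by (auto elim!: Ints_cases)
  then show "vec_of xs = x"
    using x(1) by (auto simp: vec_of_def xs_def partition_fun_def fun_eq_iff)
qed

lemma tau_integral_subset_SKron:
  assumes mn: "m > 0" "n > 0"
  shows "tau m n \<inter> Wlat (m * n) m n \<subseteq> emb ` SKron (m * n) m n"
proof
  fix p assume p: "p \<in> tau m n \<inter> Wlat (m * n) m n"
  obtain x y z where pxyz: "p = (x, y, z)" by (cases p)
  have int: "x i \<in> \<int>" "y i \<in> \<int>" "z i \<in> \<int>" for i using p by (auto simp: pxyz Wlat_def)
  have part: "partition_fun (m * n) x" "partition_fun m y" "partition_fun n z" and ms: "matrix_sums m n x y z"
    using p by (auto simp: pxyz tau_iff[OF mn])
  obtain lam where lam: "part_len (m * n) lam" "vec_of lam = x"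
    using integral_partition_fun[OF part(1)] int by blast
  obtain mu where mu: "part_len m mu" "vec_of mu = y"
    using integral_partition_fun[OF part(2)] int by blast
  obtain nu where nu: "part_len n nu" "vec_of nu = z"
    using integral_partition_fun[OF part(3)] int by blast
  have "matrix_sums m n (parts lam) (parts mu) (parts nu)"
    using ms by (simp add: lam mu nu flip: matrix_sums_vec_of)
  then have "(lam, mu, nu) \<in> SKron (m * n) m n"
    using lam mu nu weakly_stable_if_matrix_sums[OF mn] by (simp add: SKron_def part_len_def)
  moreover have "emb (lam, mu, nu) = p" by (simp add: emb_def pxyz lam mu nu)
  ultimately show "p \<in> emb ` SKron (m * n) m n" by force
qed

theorem mainTheorem5:
  fixes m n :: nat
  assumes "m > 0" and "n > 0"
  shows "(\<forall>lam mu nu. part_len (m*n) lam \<and> part_len m mu \<and> part_len n nu \<and>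
            star_eqs m n (at1 lam) (at1 mu) (at1 nu) \<longrightarrow> stable_triple lam mu nu)
         \<and> stable_face (m*n) m n (tau m n)"
proof (intro conjI allI impI)
  fix lam mu nu
  assume *: "part_len (m*n) lam \<and> part_len m mu \<and> part_len n nu \<and>
            star_eqs m n (at1 lam) (at1 mu) (at1 nu)"
  then have "matrix_sums m n (parts lam) (parts mu) (parts nu)"
    using matrix_sums_parts_iff_star_eqs[OF assms] by blast
  then have "ev_const (\<lambda>k. kron (padd al (psmul k lam)) (padd be (psmul k mu)) (padd ga (psmul k nu)))"
    if "is_part al" for al be ga
    using * that by (intro kron_stable[OF assms]) (auto simp: part_len_def)
  then show "stable_triple lam mu nu"
    by (simp add: stable_triple_def ev_const_def eventually_sequentially) blast
next
  show "stable_face (m*n) m n (tau m n)"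
    unfolding stable_face_def
    using tau_face_of_PKron[OF assms] tau_integral_subset_SKron[OF assms] by blast
qed

end
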